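(* Let $[a,b]$ be a non-trivial segment of $\mathbb{T}$, let $\omega = (-1,1)\times(\mathbb{T}\setminus[a,b])$, and let $T>0$. The Grushin equation on $\Omega=(-1,1)\times\mathbb{T}$ is not null-controllable on $\omega$ in time $T$.
   Context: $\mathbb{T}=\mathbb{R}/2\pi\mathbb{Z}$ and $\Omega=(-1,1)\times\mathbb{T}$ (variables $(x,y)$). Let $\omega\subset\Omega$ be open. The Grushin equation is said to be null-controllable on $\omega$ in time $T>0$ if for all $f_0\in L^2(\Omega)$ there exists $u\in L^2([0,T]\times\omega)$ such that the solution $f$ of $$(\partial_t-\partial_x^2-x^2\partial_y^2)f(t,x,y)=\mathbf 1_\omega u(t,x,y)\quad (t\in[0,T],\ (x,y)\in\Omega),$$ $$f(t,x,y)=0\quad (t\in[0,T],\ (x,y)\in\partial\Omega),\qquad f(0,x,y)=f_0(x,y)\quad((x,y)\in\Omega)$$ satisfies $f(T,x,y)=0$ for all $(x,y)\in\Omega$. A segment of $\mathbb{T}$ is non-trivial if it is not empty or reduced to a point. *)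

theory Defs
  imports "HOL-Analysis.Analysis"
begin

text \<open>
  The circle \<open>T = R / 2 pi Z\<close> is handled through its covering \<open>R\<close>: subsets of \<open>T\<close> and of
  \<open>(-1,1) \<times> T\<close> are given by their full (\<open>2 pi\<close>-periodic) preimages, smooth functions are
  \<open>2 pi\<close>-periodic in \<open>y\<close>, and integrals and \<open>L\<^sup>2\<close> spaces are taken over the fundamental domain
  \<open>0 \<le> y < 2 pi\<close>. Functions are complex-valued.
\<close>

definition grushin_domain :: "(real \<times> real) set" where
  "grushin_domain = {-1<..<1} \<times> {0..<2 * pi}"

text \<open>The preimage in \<open>R\<close> of the image in \<open>T\<close> of the real interval \<open>[a,b]\<close>.\<close>

definition torus_segment :: "real \<Rightarrow> real \<Rightarrow> real set" where
  "torus_segment a b = {y. \<exists>k::int. y + 2 * pi * of_int k \<in> {a..b}}"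

definition square_integrable_on :: "('a::euclidean_space \<Rightarrow> complex) \<Rightarrow> 'a set \<Rightarrow> bool"
    (infix "square'_integrable'_on" 50) where
  "f square_integrable_on S \<longleftrightarrow>
     set_borel_measurable lborel S f \<and> set_integrable lborel S (\<lambda>z. (cmod (f z))\<^sup>2)"

definition partial_x :: "(real \<times> real \<Rightarrow> complex) \<Rightarrow> real \<times> real \<Rightarrow> complex" where
  "partial_x h = (\<lambda>(x, y). vector_derivative (\<lambda>s. h (s, y)) (at x))"

definition partial_y :: "(real \<times> real \<Rightarrow> complex) \<Rightarrow> real \<times> real \<Rightarrow> complex" where
  "partial_y h = (\<lambda>(x, y). vector_derivative (\<lambda>s. h (x, s)) (at y))"

definition C1 :: "(real \<times> real \<Rightarrow> complex) \<Rightarrow> bool" where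
  "C1 h \<longleftrightarrow>
     (\<forall>x y. (\<lambda>s. h (s, y)) differentiable (at x) \<and> (\<lambda>s. h (x, s)) differentiable (at y)) \<and>
     continuous_on UNIV (partial_x h) \<and> continuous_on UNIV (partial_y h)"

definition C2 :: "(real \<times> real \<Rightarrow> complex) \<Rightarrow> bool" where
  "C2 h \<longleftrightarrow> C1 h \<and> C1 (partial_x h) \<and> C1 (partial_y h)"

definition grushin_operator :: "(real \<times> real \<Rightarrow> complex) \<Rightarrow> real \<times> real \<Rightarrow> complex" where
  "grushin_operator h = (\<lambda>(x, y).
     partial_x (partial_x h) (x, y) + complex_of_real (x\<^sup>2) * partial_y (partial_y h) (x, y))"

text \<open>
  Test functions vanish on the boundary \<open>{-1,1} \<times> T\<close>, but their normal derivatives there are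
  arbitrary: this is what encodes the Dirichlet condition on the solution below.
\<close>

definition dirichlet_test_function :: "(real \<times> real \<Rightarrow> complex) \<Rightarrow> bool" where
  "dirichlet_test_function h \<longleftrightarrow>
     C2 h \<and> (\<forall>x y. h (x, y + 2 * pi) = h (x, y)) \<and> (\<forall>y. h (-1, y) = 0 \<and> h (1, y) = 0)"

text \<open>
  \<open>f \<in> C([0,T]; L\<^sup>2)\<close> is the weak solution with initial value \<open>f0\<close> and source \<open>1\<^sub>\<omega> u\<close>. The last
  clause is the equation multiplied by a test function \<open>h\<close> and integrated over \<open>[0,\<tau>]\<close> and over
  the domain; both integrations by parts (the operator is symmetric) lose their boundary terms
  because \<open>f\<close> and \<open>h\<close> vanish at \<open>x = -1\<close> and \<open>x = 1\<close>. Since the test functions contain all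
  Dirichlet eigenfunctions of the operator, \<open>f\<close> is unique up to null sets and is the mild
  (semigroup) solution.
\<close>

definition grushin_solution ::
  "(real \<times> real) set \<Rightarrow> real \<Rightarrow> (real \<times> real \<Rightarrow> complex) \<Rightarrow> (real \<times> real \<times> real \<Rightarrow> complex) \<Rightarrow>
   (real \<Rightarrow> real \<times> real \<Rightarrow> complex) \<Rightarrow> bool" where
  "grushin_solution \<omega> T f0 u f \<longleftrightarrow>
     (\<forall>t\<in>{0..T}. f t square_integrable_on grushin_domain) \<and>
     (\<forall>s\<in>{0..T}.
        ((\<lambda>t. LINT z:grushin_domain|lborel. (cmod (f t z - f s z))\<^sup>2) \<longlongrightarrow> 0)
          (at s within {0..T})) \<and>
     (AE z\<in>grushin_domain in lborel. f 0 z = f0 z) \<and>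
     (\<forall>h. dirichlet_test_function h \<longrightarrow>
        (\<forall>\<tau>\<in>{0..T}.
           (LINT z:grushin_domain|lborel. f \<tau> z * h z)
             - (LINT z:grushin_domain|lborel. f0 z * h z)
           = (LINT t:{0..\<tau>}|lborel. LINT z:grushin_domain|lborel. f t z * grushin_operator h z)
             + (LINT (t, z):{0..\<tau>} \<times> (\<omega> \<inter> grushin_domain)|lborel. u (t, z) * h z)))"

definition null_controllable :: "(real \<times> real) set \<Rightarrow> real \<Rightarrow> bool" where
  "null_controllable \<omega> T \<longleftrightarrow>
     (\<forall>f0. f0 square_integrable_on grushin_domain \<longrightarrow>
        (\<exists>u f. u square_integrable_on ({0..T} \<times> (\<omega> \<inter> grushin_domain)) \<and>
               grushin_solution \<omega> T f0 u f \<and>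
               (AE z\<in>grushin_domain in lborel. f T z = 0)))"

end

theory Submission
  imports Defs
begin

text \<open>
  On the line, \<open>exp (n t - n x\<^sup>2 / 2 + i n y)\<close> solves the adjoint equation, so adjoint states are
  polynomials in \<open>exp (t - x\<^sup>2 / 2 + i y)\<close>; only the Dirichlet condition at \<open>x = -1, 1\<close> is violated.
  Instead of the exact Dirichlet eigenfunctions we use the chain \<open>r\<^sub>0 = exp (- n x\<^sup>2 / 2)\<close>,
  \<open>(- \<partial>\<^sub>x\<^sup>2 + n\<^sup>2 x\<^sup>2 - n) r\<^sub>j\<^sub>+\<^sub>1 = exp (- n) r\<^sub>j\<close>, in which every \<open>r\<^sub>j\<^sub>+\<^sub>1\<close> vanishes at the
  boundary. The combination \<open>\<Sum>\<^sub>i exp (n (t - i)) t\<^sup>i / i! r\<^sub>L\<^sub>-\<^sub>i exp (i n y)\<close>, \<open>i < L\<close>, solves the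
  adjoint equation up to an error of size \<open>exp (n (t - L))\<close>, which is harmless for \<open>L \<ge> T + 1\<close>.

  Green's function turns \<open>r\<^sub>j\<close> into an average of \<open>exp (- n \<sigma>)\<close> over \<open>\<sigma> \<ge> 0\<close>. Multiplying the
  coefficients of a polynomial by \<open>r\<^sub>j(x)\<close> thus averages its dilations and does not increase its
  supremum on a star-shaped set \<open>K\<close>, here a small disc together with a sector of radius \<open>exp T\<close>
  whose opening is the missing segment. Controllability bounds the moments of the initial state,
  paired with the coefficients of any polynomial \<open>p\<close>, by a constant times \<open>sup\<^sub>K |p|\<close>. For an
  initial state with moments \<open>\<xi>\<^sup>n\<close>, where \<open>\<xi> = exp (- 1/2)\<close> lies in the opening, this reads
  \<open>|p(\<xi>)| \<le> C sup\<^sub>K |p|\<close>. Powers of a polynomial that is larger at \<open>\<xi>\<close> than on \<open>K\<close> contradict it.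
\<close>

section \<open>The chain of generalized modes\<close>

text \<open>Test functions have to be \<open>C2\<close> on the whole plane, not only for |x| \<le>
  1, so the modes are built on the whole line and both signs of \<open>x\<close> matter. An interval
  that runs backwards is empty and contributes 0.\<close>

definition primitive :: "(real \<Rightarrow> real) \<Rightarrow> real \<Rightarrow> real" where
  "primitive f x = integral {0..x} f - integral {x..0} f"

lemma primitive_nonneg_eq: "0 \<le> x \<Longrightarrow> primitive f x = integral {0..x} f"
  by (cases "x = 0") (auto simp: primitive_def)

text \<open>Reflection of the interval of integration. With \<open>c = 1\<close> an even function
  gets an odd primitive, with \<open>c = -1\<close> an odd one gets an even primitive;
  \<open>tower_even\<close> uses both.\<close>

lemma primitive_minus:
  assumes "\<And>x. f (- x) = c * f x"
  shows "primitive f (- x) = - c * primitive f x"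
proof -
  have "integral {u..v} f = c * integral {-v..-u} f" for u v
  proof -
    have "integral {u..v} f = integral {-v..-u} (\<lambda>x. f (- x))"
      using integral_reflect_real[of v u f] by simp
    then show ?thesis by (simp add: assms)
  qed
  from this[of 0 "-x"] this[of "-x" 0] show ?thesis
    by (simp add: primitive_def algebra_simps)
qed

lemma primitive_has_derivative:
  assumes "continuous_on UNIV f"
  shows "(primitive f has_real_derivative f x) (at x)"
proof -
  \<comment> \<open>A base point to the left of both 0 and \<open>x\<close>: near \<open>x\<close>,
    on either side of 0, the primitive is \<open>integral {a..u} f\<close> minus a constant, and the
    fundamental theorem applies.\<close>
  define a where "a = - \<bar>x\<bar> - 1"
  define b where "b = \<bar>x\<bar> + 1"
  have mem: "x \<in> {a<..<b}" by (auto simp: a_def b_def)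
  have cf: "continuous_on S f" for S using assms continuous_on_subset by blast
  have int: "f integrable_on {u..v}" for u v using cf integrable_continuous_real by blast
  have eq: "primitive f u = integral {a..u} f - integral {a..0} f" if "u \<in> {a<..<b}" for u
  proof (cases "0 \<le> u")
    case True
    with Henstock_Kurzweil_Integration.integral_combine[of a 0 u f] int that show ?thesis
      by (simp add: primitive_nonneg_eq a_def algebra_simps)
  next
    case False
    with Henstock_Kurzweil_Integration.integral_combine[of a u 0 f] int that show ?thesis
      by (simp add: primitive_def algebra_simps)
  qed
  have "((\<lambda>u. integral {a..u} f - integral {a..0} f) has_real_derivative f x) (at x within {a..b})"
    using DERIV_diff[OF integral_has_real_derivative[OF cf[of "{a..b}"], of x]
        DERIV_const[of "integral {a..0} f"]] mem
    by simp
  then have "((\<lambda>u. integral {a..u} f - integral {a..0} f) has_real_derivative f x) (at x within {a<..<b})"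
    by (rule DERIV_subset) auto
  then have d: "((\<lambda>u. integral {a..u} f - integral {a..0} f) has_real_derivative f x) (at x)"
    using at_within_open[OF mem] by simp
  have e: "eventually (\<lambda>u. primitive f u = integral {a..u} f - integral {a..0} f) (nhds x)"
    using eventually_mono[OF eventually_nhds_in_open[OF open_greaterThanLessThan mem] eq] by simp
  show ?thesis
    by (rule iffD2[OF DERIV_cong_ev[OF refl e refl] d])
qed

lemma primitive_continuous_on: "continuous_on UNIV f \<Longrightarrow> continuous_on S (primitive f)"
  by (meson DERIV_isCont continuous_at_imp_continuous_on primitive_has_derivative)

lemma primitive_diff:
  assumes "continuous_on UNIV f" "u \<le> v"
  shows "primitive f v - primitive f u = integral {u..v} f"
proof -
  have "(f has_integral (primitive f v - primitive f u)) {u..v}"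
    by (intro fundamental_theorem_of_calculus[OF assms(2)])
       (use primitive_has_derivative[OF assms(1)] in
         \<open>auto simp: has_real_derivative_iff_has_vector_derivative[symmetric] intro: DERIV_subset\<close>)
  then show ?thesis by (simp add: integral_unique)
qed

section \<open>Modes and their Green's formula\<close>

text \<open>The factor \<open>R\<close> of a mode \<open>exp (- n x^2 / 2) R\<close>. With
  \<open>Q\<close> the previous factor, the chain equation becomes
  \<open>(exp (- n x^2) R')' = - exp (- n) exp (- n x^2) Q\<close>. It is integrated once from 0,
  which keeps \<open>R\<close> even, and once from \<open>x\<close> to 1, which makes
  \<open>R\<close> vanish at 1 and hence at -1.\<close>

primrec tower :: "nat \<Rightarrow> nat \<Rightarrow> real \<Rightarrow> real" where
  "tower n 0 = (\<lambda>x. 1)"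
| "tower n (Suc j) = (\<lambda>x.
     exp (- real n) * (primitive (\<lambda>s. exp (real n * s\<^sup>2) * primitive (\<lambda>r. exp (- real n * r\<^sup>2) * tower n j r) s) 1
                - primitive (\<lambda>s. exp (real n * s\<^sup>2) * primitive (\<lambda>r. exp (- real n * r\<^sup>2) * tower n j r) s) x))"

definition mode :: "nat \<Rightarrow> nat \<Rightarrow> real \<Rightarrow> real" where
  "mode n j x = exp (- real n * x\<^sup>2 / 2) * tower n j x"

lemma tower_continuous_on [continuous_intros]: "continuous_on S (tower n j)"
proof -
  have "continuous_on UNIV (tower n j)"
    by (induction j) (auto intro!: continuous_intros primitive_continuous_on)
  then show ?thesis using continuous_on_subset by blast
qed

lemma mode_continuous_on [continuous_intros]: "continuous_on S (mode n j)"
  unfolding mode_def by (intro continuous_intros) auto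

lemma tower_even: "tower n j (- x) = tower n j x"
proof (induction j arbitrary: x)
  case (Suc j)
  let ?p = "primitive (\<lambda>r. exp (- real n * r\<^sup>2) * tower n j r)"
  have "?p (- s) = - 1 * ?p s" for s
    by (rule primitive_minus) (simp add: Suc.IH)
  then have "primitive (\<lambda>s. exp (real n * s\<^sup>2) * ?p s) (- x) = - (- 1) * primitive (\<lambda>s. exp (real n * s\<^sup>2) * ?p s) x" for x
    by (intro primitive_minus) simp
  then show ?case by simp
qed simp

lemma mode_even: "mode n j (- x) = mode n j x"
  by (simp add: mode_def tower_even)

lemma mode_boundary: "mode n (Suc j) 1 = 0" "mode n (Suc j) (- 1) = 0"
proof -
  show "mode n (Suc j) 1 = 0" by (simp add: mode_def)
  then show "mode n (Suc j) (- 1) = 0" using mode_even[of n "Suc j" 1] by simp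
qed

lemma mode_0: "mode n 0 x = exp (- real n * x\<^sup>2 / 2)"
  by (simp add: mode_def)

text \<open>The integrand of Green's formula with all exponentials collected; a factor
  \<open>exp (- n r^2 / 2)\<close> is absorbed into \<open>mode n j r\<close>. What remains is a
  pure \<open>n\<close>-th power of a number that is at most 1 for |s| \<le> 1, so that it acts on
  \<open>z ^ n\<close> as a dilation of \<open>z\<close>.\<close>

definition mode_kernel :: "real \<Rightarrow> real \<Rightarrow> real \<Rightarrow> real" where
  "mode_kernel x s r = exp (- (1 - s\<^sup>2 + x\<^sup>2 / 2 + r\<^sup>2 / 2))"

lemma mode_Suc:
  assumes "0 \<le> x" "x \<le> 1"
  shows "mode n (Suc j) x =
    integral {x..1} (\<lambda>s. integral {0..s} (\<lambda>r. mode_kernel x s r ^ n * mode n j r))"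
proof -
  let ?p = "primitive (\<lambda>r. exp (- real n * r\<^sup>2) * tower n j r)"
  have cp: "continuous_on UNIV (\<lambda>r::real. exp (- real n * r\<^sup>2) * tower n j r)"
    by (intro continuous_intros)
  have "continuous_on UNIV (\<lambda>s::real. exp (real n * s\<^sup>2) * ?p s)"
    by (intro continuous_intros primitive_continuous_on cp)
  from primitive_diff[OF this assms(2)]
  have "mode n (Suc j) x = exp (- real n * x\<^sup>2 / 2) * exp (- real n) * integral {x..1} (\<lambda>s. exp (real n * s\<^sup>2) * ?p s)"
    by (simp add: mode_def)
  also have "\<dots> = integral {x..1} (\<lambda>s. exp (- real n * x\<^sup>2 / 2) * exp (- real n) * (exp (real n * s\<^sup>2) * ?p s))"
    by simp
  also have "\<dots> = integral {x..1} (\<lambda>s. integral {0..s} (\<lambda>r. mode_kernel x s r ^ n * mode n j r))"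
  proof (rule integral_cong)
    fix s assume s: "s \<in> {x..1}"
    then have "?p s = integral {0..s} (\<lambda>r. exp (- real n * r\<^sup>2) * tower n j r)"
      using assms by (simp add: primitive_nonneg_eq)
    then have "exp (- real n * x\<^sup>2 / 2) * exp (- real n) * (exp (real n * s\<^sup>2) * ?p s)
      = exp (- real n * x\<^sup>2 / 2) * exp (- real n) * exp (real n * s\<^sup>2) * integral {0..s} (\<lambda>r. exp (- real n * r\<^sup>2) * tower n j r)"
      by simp
    also have "\<dots> = integral {0..s} (\<lambda>r. exp (- real n * x\<^sup>2 / 2) * exp (- real n) * exp (real n * s\<^sup>2) * (exp (- real n * r\<^sup>2) * tower n j r))"
      by (simp only: integral_mult_right)
    also have "\<dots> = integral {0..s} (\<lambda>r. mode_kernel x s r ^ n * mode n j r)"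
      by (intro integral_cong)
         (auto simp: mode_def mode_kernel_def exp_of_nat_mult[symmetric] mult_exp_exp mult.assoc[symmetric] algebra_simps)
    finally show "exp (- real n * x\<^sup>2 / 2) * exp (- real n) * (exp (real n * s\<^sup>2) * ?p s)
      = integral {0..s} (\<lambda>r. mode_kernel x s r ^ n * mode n j r)" .
  qed
  finally show ?thesis .
qed

text \<open>Provides the two derivatives as witnesses for \<open>C2_separable\<close>; the last
  clause is the chain equation solved for the second derivative.\<close>

lemma mode_derivatives:
  obtains k' k'' where
    "\<And>x. (mode n (Suc j) has_real_derivative k' x) (at x)"
    "\<And>x. (k' has_real_derivative k'' x) (at x)"
    "continuous_on UNIV k''"
    "\<And>x. k'' x = ((real n)\<^sup>2 * x\<^sup>2 - real n) * mode n (Suc j) x - exp (- real n) * mode n j x"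
proof -
  let ?p = "primitive (\<lambda>r. exp (- real n * r\<^sup>2) * tower n j r)"
  let ?R = "tower n (Suc j)"
  let ?e = "\<lambda>x. exp (- real n * x\<^sup>2 / 2)"
  \<comment> \<open>The minus sign comes from \<open>x\<close> being the lower limit of the outer
    integral.\<close>
  define R' where "R' x = - exp (- real n) * (exp (real n * x\<^sup>2) * ?p x)" for x
  have cp: "continuous_on UNIV (\<lambda>r::real. exp (- real n * r\<^sup>2) * tower n j r)"
    by (intro continuous_intros)
  have cq: "continuous_on UNIV (\<lambda>s::real. exp (real n * s\<^sup>2) * ?p s)"
    by (intro continuous_intros primitive_continuous_on cp)
  have R: "(?R has_real_derivative R' x) (at x)" for x
    unfolding tower.simps R'_def
    by (rule DERIV_cong[OF DERIV_cmult[OF DERIV_diff[OF DERIV_const primitive_has_derivative[OF cq]]]]) simp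
  \<comment> \<open>The chain equation after division by the Gaussian
    \<open>exp (- n x^2 / 2)\<close>.\<close>
  have R'd: "(R' has_real_derivative 2 * real n * x * R' x - exp (- real n) * tower n j x) (at x)" for x
  proof -
    have F: "((\<lambda>x. exp (real n * x\<^sup>2)) has_real_derivative exp (real n * x\<^sup>2) * (2 * real n * x)) (at x)" for x
      by (auto intro!: derivative_eq_intros)
    have "(R' has_real_derivative - exp (- real n) * (exp (real n * x\<^sup>2) * (2 * real n * x) * ?p x
        + exp (real n * x\<^sup>2) * (exp (- real n * x\<^sup>2) * tower n j x))) (at x)"
      unfolding R'_def
      by (rule DERIV_cong[OF DERIV_cmult[OF DERIV_mult[OF F primitive_has_derivative[OF cp]]]])
         (simp add: algebra_simps)
    moreover have "exp (real n * x\<^sup>2) * (exp (- real n * x\<^sup>2) * tower n j x) = tower n j x"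
      by (simp add: mult.assoc[symmetric] mult_exp_exp)
    ultimately show ?thesis
      by (elim DERIV_cong) (simp add: R'_def algebra_simps)
  qed
  have E: "(?e has_real_derivative - real n * x * ?e x) (at x)" for x
    by (auto intro!: derivative_eq_intros)
  define k' where "k' x = - real n * x * ?e x * ?R x + ?e x * R' x" for x
  define k'' where "k'' x = ((real n)\<^sup>2 * x\<^sup>2 - real n) * mode n (Suc j) x - exp (- real n) * mode n j x" for x
  show thesis
  proof
    show "(mode n (Suc j) has_real_derivative k' x) (at x)" for x
      unfolding mode_def[abs_def] k'_def
      by (rule DERIV_cong[OF DERIV_mult[OF E R]]) (simp add: algebra_simps)
    show "(k' has_real_derivative k'' x) (at x)" for x
      unfolding k'_def[abs_def]
      by (rule DERIV_cong[OF DERIV_add[OF DERIV_mult[OF DERIV_mult[OF DERIV_cmult_Id[of "- real n"] E] R] DERIV_mult[OF E R'd]]])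
         (simp add: k''_def mode_def algebra_simps power2_eq_square del: tower.simps)
    show "continuous_on UNIV k''" unfolding k''_def[abs_def] by (intro continuous_intros)
    show "k'' x = ((real n)\<^sup>2 * x\<^sup>2 - real n) * mode n (Suc j) x - exp (- real n) * mode n j x" for x
      by (simp add: k''_def)
  qed
qed

section \<open>The multiplier estimate on a star-shaped set\<close>

text \<open>For \<open>c = cos d\<close> the nonzero points of the second piece are those of modulus
  at most \<open>M\<close> whose argument has distance at least \<open>d\<close> from 0. The radius
  1/2 lies between \<open>exp (- 1)\<close>, which bounds the dilations in the error term, and
  \<open>exp (- 1/2)\<close>, the point to be separated.\<close>

definition keyhole :: "real \<Rightarrow> real \<Rightarrow> complex set" where
  "keyhole c M = {z. cmod z \<le> 1/2 \<or> (cmod z \<le> M \<and> Re z \<le> c * cmod z)}"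

lemma keyhole_scale:
  assumes "z \<in> keyhole c M" "0 \<le> s" "s \<le> 1"
  shows "complex_of_real s * z \<in> keyhole c M"
proof -
  have n: "cmod (complex_of_real s * z) = s * cmod z" using assms by (simp add: norm_mult)
  have le: "s * cmod z \<le> cmod z" using assms by (simp add: mult_left_le_one_le)
  show ?thesis
  proof (cases "cmod z \<le> 1/2")
    case True
    with n le show ?thesis by (simp add: keyhole_def)
  next
    case False
    with assms have "cmod z \<le> M" "Re z \<le> c * cmod z" by (auto simp: keyhole_def)
    then have "s * Re z \<le> c * (s * cmod z)" "s * cmod z \<le> M"
      using mult_left_mono[of "Re z" "c * cmod z" s] assms le by (auto simp: algebra_simps)
    then show ?thesis unfolding keyhole_def using n by (simp del: of_real_mult)
  qed
qed

text \<open>The kernel is a function of \<open>s\<close> times a function of \<open>r\<close>, so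
  the inner integral is an explicit factor times a \<open>primitive\<close>. The identification is
  made for \<open>s \<ge> 0\<close>: for negative \<open>s\<close> the set \<open>{0..s}\<close> is
  empty, while the primitive need not vanish.\<close>

lemma mode_inner_continuous:
  assumes "T \<subseteq> {0..}"
  shows "continuous_on T (\<lambda>s. integral {0..s} (\<lambda>r. mode_kernel x s r ^ n * mode n j r))"
proof -
  have "continuous_on T (\<lambda>s. exp (- (1 + x\<^sup>2 / 2)) ^ n * exp (s\<^sup>2) ^ n * primitive (\<lambda>r. exp (- (r\<^sup>2 / 2)) ^ n * mode n j r) s)"
    by (intro continuous_intros primitive_continuous_on) simp_all
  moreover have "integral {0..s} (\<lambda>r. mode_kernel x s r ^ n * mode n j r)
      = exp (- (1 + x\<^sup>2 / 2)) ^ n * exp (s\<^sup>2) ^ n * primitive (\<lambda>r. exp (- (r\<^sup>2 / 2)) ^ n * mode n j r) s"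
    if "s \<in> T" for s
  proof -
    have "mode_kernel x s r = exp (- (1 + x\<^sup>2 / 2)) * exp (s\<^sup>2) * exp (- (r\<^sup>2 / 2))" for r
      by (simp add: mode_kernel_def mult_exp_exp)
    then have "integral {0..s} (\<lambda>r. mode_kernel x s r ^ n * mode n j r)
      = integral {0..s} (\<lambda>r. exp (- (1 + x\<^sup>2 / 2)) ^ n * exp (s\<^sup>2) ^ n * (exp (- (r\<^sup>2 / 2)) ^ n * mode n j r))"
      by (simp add: power_mult_distrib mult.assoc)
    also have "\<dots> = exp (- (1 + x\<^sup>2 / 2)) ^ n * exp (s\<^sup>2) ^ n * integral {0..s} (\<lambda>r. exp (- (r\<^sup>2 / 2)) ^ n * mode n j r)"
      by (rule integral_mult_right)
    finally show ?thesis using that assms by (auto simp: primitive_nonneg_eq)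
  qed
  ultimately show ?thesis by (simp cong: continuous_on_cong)
qed

text \<open>Induction along the chain. At level 0 the multiplier is a dilation by
  \<open>exp (- x^2 / 2)\<close>. At the next level Green's formula integrates polynomials of the
  level below, taken at dilated points, which stay in the keyhole by \<open>keyhole_scale\<close>.
  Both integrations run over intervals of length at most 1, so the bound \<open>B\<close>
  survives.\<close>

lemma mode_multiplier:
  fixes p :: "nat \<Rightarrow> complex"
  assumes S: "finite S"
    and bound: "\<And>z. z \<in> keyhole c M \<Longrightarrow> cmod (\<Sum>n\<in>S. p n * z ^ n) \<le> B"
    and z: "z \<in> keyhole c M" and x: "\<bar>x\<bar> \<le> 1"
  shows "cmod (\<Sum>n\<in>S. p n * mode n j x * z ^ n) \<le> B"
proof -
  \<comment> \<open>Green's formula is available for \<open>0 \<le> x \<le> 1\<close>; evenness of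
    the modes supplies negative \<open>x\<close> at the end.\<close>
  have pos: "cmod (\<Sum>n\<in>S. p n * mode n j x * z ^ n) \<le> B"
    if "z \<in> keyhole c M" "0 \<le> x" "x \<le> 1" for x z
    using that
  proof (induction j arbitrary: x z)
    case 0
    have "(\<Sum>n\<in>S. p n * mode n 0 x * z ^ n) = (\<Sum>n\<in>S. p n * (complex_of_real (exp (- x\<^sup>2 / 2)) * z) ^ n)"
      by (intro sum.cong refl)
         (simp add: mode_0 power_mult_distrib exp_of_nat_mult[symmetric] flip: of_real_power)
    moreover have "complex_of_real (exp (- x\<^sup>2 / 2)) * z \<in> keyhole c M"
      using 0 by (intro keyhole_scale) auto
    ultimately show ?case using bound by simp
  next
    case (Suc j)
    define E where "E = mode_kernel x"
    \<comment> \<open>The polynomial of level \<open>j\<close> at a dilated point, with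
      \<open>r\<close> in place of \<open>x\<close>: this is what the induction hypothesis
      bounds.\<close>
    define F where "F s r = (\<Sum>n\<in>S. p n * mode n j r * (complex_of_real (E s r) * z) ^ n)" for s r
    have B0: "0 \<le> B" using bound[OF z] norm_ge_zero order_trans by blast
    have FB: "cmod (F s r) \<le> B" if "s \<in> {x..1}" "r \<in> {0..s}" for s r
    proof -
      have "s\<^sup>2 \<le> 1" using that Suc.prems by (simp add: power_le_one)
      then have "0 \<le> 1 - s\<^sup>2 + x\<^sup>2 / 2 + r\<^sup>2 / 2" by (simp add: add_nonneg_nonneg)
      then have "0 \<le> E s r" "E s r \<le> 1" unfolding E_def mode_kernel_def by auto
      then have "complex_of_real (E s r) * z \<in> keyhole c M"
        using Suc.prems keyhole_scale by blast
      then show ?thesis unfolding F_def using that Suc.prems by (intro Suc.IH) auto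
    qed
    have cr: "continuous_on T (\<lambda>r. E s r ^ n * mode n j r)" for T s n
      unfolding E_def mode_kernel_def by (intro continuous_intros; simp)
    have cF: "continuous_on T (F s)" for T s
      unfolding F_def E_def mode_kernel_def by (intro continuous_intros; simp)
    have inner: "integral {0..s} (F s) = (\<Sum>n\<in>S. p n * z ^ n * complex_of_real (integral {0..s} (\<lambda>r. E s r ^ n * mode n j r)))" for s
    proof -
      have "integral {0..s} (F s) = integral {0..s} (\<lambda>r. \<Sum>n\<in>S. p n * z ^ n * complex_of_real (E s r ^ n * mode n j r))"
        unfolding F_def by (intro integral_cong sum.cong refl) (simp add: power_mult_distrib)
      also have "\<dots> = (\<Sum>n\<in>S. integral {0..s} (\<lambda>r. p n * z ^ n * complex_of_real (E s r ^ n * mode n j r)))"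
        by (intro integral_sum S integrable_continuous_real continuous_intros cr)
      also have "\<dots> = (\<Sum>n\<in>S. p n * z ^ n * complex_of_real (integral {0..s} (\<lambda>r. E s r ^ n * mode n j r)))"
      proof (intro sum.cong refl)
        fix n
        have "((\<lambda>r. complex_of_real (E s r ^ n * mode n j r)) has_integral
            complex_of_real (integral {0..s} (\<lambda>r. E s r ^ n * mode n j r))) {0..s}"
          by (intro has_integral_of_real integrable_integral integrable_continuous_real cr)
        from has_integral_mult_right[OF this]
        show "integral {0..s} (\<lambda>r. p n * z ^ n * complex_of_real (E s r ^ n * mode n j r))
          = p n * z ^ n * complex_of_real (integral {0..s} (\<lambda>r. E s r ^ n * mode n j r))"
          by (rule integral_unique)
      qed
      finally show ?thesis .
    qed
    have co: "continuous_on {x..1} (\<lambda>s. integral {0..s} (\<lambda>r. E s r ^ n * mode n j r))" for n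
      unfolding E_def using Suc.prems by (intro mode_inner_continuous) auto
    have "(\<Sum>n\<in>S. p n * mode n (Suc j) x * z ^ n)
      = (\<Sum>n\<in>S. p n * z ^ n * complex_of_real (integral {x..1} (\<lambda>s. integral {0..s} (\<lambda>r. E s r ^ n * mode n j r))))"
      using Suc.prems by (intro sum.cong refl) (simp add: mode_Suc E_def)
    also have "\<dots> = (\<Sum>n\<in>S. integral {x..1} (\<lambda>s. p n * z ^ n * complex_of_real (integral {0..s} (\<lambda>r. E s r ^ n * mode n j r))))"
    proof (intro sum.cong refl)
      fix n
      have "((\<lambda>s. complex_of_real (integral {0..s} (\<lambda>r. E s r ^ n * mode n j r))) has_integral
          complex_of_real (integral {x..1} (\<lambda>s. integral {0..s} (\<lambda>r. E s r ^ n * mode n j r)))) {x..1}"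
        by (intro has_integral_of_real integrable_integral integrable_continuous_real co)
      from has_integral_mult_right[OF this]
      show "p n * z ^ n * complex_of_real (integral {x..1} (\<lambda>s. integral {0..s} (\<lambda>r. E s r ^ n * mode n j r)))
        = integral {x..1} (\<lambda>s. p n * z ^ n * complex_of_real (integral {0..s} (\<lambda>r. E s r ^ n * mode n j r)))"
        by (rule integral_unique[symmetric])
    qed
    also have "\<dots> = integral {x..1} (\<lambda>s. \<Sum>n\<in>S. p n * z ^ n * complex_of_real (integral {0..s} (\<lambda>r. E s r ^ n * mode n j r)))"
      by (intro integral_sum[symmetric] S integrable_continuous_real continuous_intros co)
    also have "\<dots> = integral {x..1} (\<lambda>s. integral {0..s} (F s))"
      by (simp add: inner)
    finally have eq: "(\<Sum>n\<in>S. p n * mode n (Suc j) x * z ^ n) = integral {x..1} (\<lambda>s. integral {0..s} (F s))" .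
    have innerB: "cmod (integral {0..s} (F s)) \<le> B" if "s \<in> {x..1}" for s
    proof -
      have "cmod (integral {0..s} (F s)) \<le> B * (s - 0)"
        by (rule integral_bound) (use that Suc.prems FB cF in auto)
      also have "\<dots> \<le> B" using that B0 Suc.prems by (simp add: mult_left_le)
      finally show ?thesis .
    qed
    have "continuous_on {x..1} (\<lambda>s. integral {0..s} (F s))"
      unfolding inner by (intro continuous_intros co)
    then have "cmod (integral {x..1} (\<lambda>s. integral {0..s} (F s))) \<le> B * (1 - x)"
      by (intro integral_bound) (use Suc.prems innerB in auto)
    also have "\<dots> \<le> B" using B0 Suc.prems by (simp add: mult_left_le)
    finally show ?case unfolding eq .
  qed
  show ?thesis
  proof (cases "0 \<le> x")
    case True
    with pos z x show ?thesis by auto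
  next
    case False
    with pos[of z "- x"] z x show ?thesis by (simp add: mode_even)
  qed
qed

section \<open>Lower bounds for the modes near x = 0\<close>

lemma mode_nonneg:
  assumes "0 \<le> x" "x \<le> 1"
  shows "0 \<le> mode n j x"
  using assms
proof (induction j arbitrary: x)
  case (Suc j)
  have a: "0 \<le> integral {0..s} (\<lambda>r. mode_kernel x s r ^ n * mode n j r)" if "s \<in> {x..1}" for s
    using that Suc
    by (intro integral_nonneg integrable_continuous_real)
       (auto simp: mode_kernel_def intro!: continuous_intros)
  have b: "continuous_on {x..1} (\<lambda>s. integral {0..s} (\<lambda>r. mode_kernel x s r ^ n * mode n j r))"
    using Suc.prems by (intro mode_inner_continuous) auto
  show ?case
    unfolding mode_Suc[OF Suc.prems] by (rule integral_nonneg[OF integrable_continuous_real[OF b] a])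
qed (simp add: mode_0)

text \<open>In Green's formula only the square \<open>s \<in> {1-d..1}\<close>,
  \<open>r \<in> {0..d}\<close> of area \<open>d^2\<close> is kept. There the kernel exponent is at
  most \<open>2 d + d/2 + d/2 = 3 d\<close>. Hence close to \<open>x = 0\<close> the modes decay in
  \<open>n\<close> at an arbitrarily small rate, which allows \<open>initial_datum\<close> to divide
  by their integrals.\<close>

lemma mode_lower_bound:
  assumes "0 \<le> x" "x \<le> d" "0 < d" "d \<le> 1/2"
  shows "d ^ (2 * j) * exp (- 3 * d) ^ (n * (j + 1)) \<le> mode n j x"
  using assms(1,2)
proof (induction j arbitrary: x)
  case 0
  have "x\<^sup>2 \<le> d * 1" using mult_mono[of x d x 1] 0 assms by (simp add: power2_eq_square)
  then have "exp (- 3 * d) ^ n \<le> exp (- x\<^sup>2 / 2) ^ n"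
    using assms by (intro power_mono) auto
  also have "exp (- x\<^sup>2 / 2) ^ n = mode n 0 x"
    by (simp add: mode_0 exp_of_nat_mult[symmetric])
  finally show ?case by simp
next
  case (Suc j)
  define l where "l = d ^ (2 * j) * exp (- 3 * d) ^ (n * (j + 1))"
  have l0: "0 \<le> l" using assms by (simp add: l_def)
  let ?k = "\<lambda>s r. mode_kernel x s r ^ n * mode n j r"
  have ck: "continuous_on T (?k s)" for T s
    unfolding mode_kernel_def by (intro continuous_intros; simp)
  have k0: "0 \<le> ?k s r" if "0 \<le> r" "r \<le> 1" for s r
    using mode_nonneg that by (simp add: mode_kernel_def)
  have low: "d * (exp (- 3 * d) ^ n * l) \<le> integral {0..s} (?k s)" if s: "s \<in> {1-d..1}" for s
  proof -
    have "d * (exp (- 3 * d) ^ n * l) = integral {0..d} (\<lambda>r. exp (- 3 * d) ^ n * l)"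
      using assms by simp
    also have "\<dots> \<le> integral {0..d} (?k s)"
    proof (rule integral_le[OF integrable_continuous_real integrable_continuous_real[OF ck]])
      show "continuous_on {0..d} (\<lambda>r. exp (- 3 * d) ^ n * l)" by simp
      fix r assume r: "r \<in> {0..d}"
      have sq: "y\<^sup>2 \<le> d * 1" if "0 \<le> y" "y \<le> d" for y
        using mult_mono[of y d y 1] that assms by (simp add: power2_eq_square)
      have "1 - 2 * d \<le> (1 - d)\<^sup>2" by (simp add: power2_eq_square algebra_simps)
      also have "\<dots> \<le> s\<^sup>2" using s assms by (intro power_mono) auto
      finally have "exp (- 3 * d) \<le> mode_kernel x s r"
        using sq[of x] sq[of r] r Suc.prems unfolding mode_kernel_def by auto
      then have "exp (- 3 * d) ^ n \<le> mode_kernel x s r ^ n" by (intro power_mono) auto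
      moreover have "l \<le> mode n j r" using Suc.IH[of r] r by (simp add: l_def)
      ultimately show "exp (- 3 * d) ^ n * l \<le> ?k s r"
        using l0 by (intro mult_mono) (auto simp: mode_kernel_def)
    qed
    \<comment> \<open>The integrand is nonnegative and \<open>d \<le> 1 - d \<le> s\<close> because
      \<open>d \<le> 1/2\<close>. Likewise \<open>x \<le> d \<le> 1 - d\<close> for the outer
      integral below.\<close>
    also have "\<dots> \<le> integral {0..s} (?k s)"
      by (rule integral_subset_le[OF _ integrable_continuous_real[OF ck] integrable_continuous_real[OF ck]])
         (use s assms k0 in auto)
    finally show ?thesis .
  qed
  have co: "continuous_on T (\<lambda>s. integral {0..s} (?k s))" if "T \<subseteq> {0..}" for T
    using that by (rule mode_inner_continuous)
  have "d ^ (2 * Suc j) * exp (- 3 * d) ^ (n * (Suc j + 1)) = d * (d * (exp (- 3 * d) ^ n * l))"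
    by (simp add: l_def power_add)
  also have "\<dots> = integral {1-d..1} (\<lambda>s. d * (exp (- 3 * d) ^ n * l))"
    using assms by simp
  also have "\<dots> \<le> integral {1-d..1} (\<lambda>s. integral {0..s} (?k s))"
    by (intro integral_le integrable_continuous_real continuous_intros co low) (use assms in auto)
  also have "\<dots> \<le> integral {x..1} (\<lambda>s. integral {0..s} (?k s))"
    by (rule integral_subset_le[OF _ integrable_continuous_real[OF co] integrable_continuous_real[OF co]])
       (use Suc.prems assms in \<open>auto intro!: integral_nonneg[OF integrable_continuous_real[OF ck]] k0\<close>)
  also have "\<dots> = mode n (Suc j) x"
    using Suc.prems assms by (simp add: mode_Suc)
  finally show ?case .
qed

section \<open>Polynomial approximation by pole pushing\<close>

definition poly_approximable :: "complex set \<Rightarrow> (complex \<Rightarrow> complex) \<Rightarrow> bool" where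
  "poly_approximable S g \<longleftrightarrow> (\<forall>e>0. \<exists>q. \<forall>z\<in>S. cmod (g z - poly q z) < e)"

lemma poly_approximable_poly: "poly_approximable S (poly q)"
  unfolding poly_approximable_def by (auto intro!: exI[of _ q])

lemma poly_approximable_const: "poly_approximable S (\<lambda>z. c)"
  unfolding poly_approximable_def by (auto intro!: exI[of _ "[:c:]"])

lemma poly_approximable_limit:
  assumes "\<And>e. e > 0 \<Longrightarrow> \<exists>h. poly_approximable S h \<and> (\<forall>z\<in>S. cmod (g z - h z) < e)"
  shows "poly_approximable S g"
  unfolding poly_approximable_def
proof (intro allI impI)
  fix e :: real assume "e > 0"
  then obtain h where h: "poly_approximable S h" "\<forall>z\<in>S. cmod (g z - h z) < e / 2"
    using assms[of "e / 2"] by auto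
  then obtain q where q: "\<forall>z\<in>S. cmod (h z - poly q z) < e / 2"
    using \<open>e > 0\<close> unfolding poly_approximable_def by (meson half_gt_zero)
  have "cmod (g z - poly q z) < e" if "z \<in> S" for z
    using h(2) q that norm_triangle_lt[of "g z - h z" "h z - poly q z" e] by fastforce
  then show "\<exists>q. \<forall>z\<in>S. cmod (g z - poly q z) < e" by blast
qed

lemma poly_approximable_add:
  assumes "poly_approximable S g" "poly_approximable S h"
  shows "poly_approximable S (\<lambda>z. g z + h z)"
  unfolding poly_approximable_def
proof (intro allI impI)
  fix e :: real assume "e > 0"
  then obtain p q where p: "\<forall>z\<in>S. cmod (g z - poly p z) < e / 2"
    and q: "\<forall>z\<in>S. cmod (h z - poly q z) < e / 2"
    using assms unfolding poly_approximable_def by (meson half_gt_zero)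
  have "cmod (g z + h z - poly (p + q) z) < e" if "z \<in> S" for z
    using p q that norm_triangle_lt[of "g z - poly p z" "h z - poly q z" e]
    by (fastforce simp: algebra_simps)
  then show "\<exists>q. \<forall>z\<in>S. cmod (g z + h z - poly q z) < e" by blast
qed

lemma poly_approximable_mult:
  assumes g: "poly_approximable S g" and h: "poly_approximable S h"
    and B: "\<And>z. z \<in> S \<Longrightarrow> cmod (g z) \<le> B" "\<And>z. z \<in> S \<Longrightarrow> cmod (h z) \<le> B"
  shows "poly_approximable S (\<lambda>z. g z * h z)"
  unfolding poly_approximable_def
proof (intro allI impI)
  fix e :: real assume e: "e > 0"
  \<comment> \<open>As \<open>d \<le> 1\<close>, the approximant of \<open>h\<close> is bounded by
    \<open>M + 1 \<le> 2 M\<close>. The total error is then at most \<open>M d + 2 M d\<close>,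
    which is below \<open>4 M d \<le> e\<close>.\<close>
  define M where "M = \<bar>B\<bar> + 1"
  define d where "d = min 1 (e / (4 * M))"
  have M: "M \<ge> 1" "\<bar>B\<bar> \<le> M" by (auto simp: M_def)
  then have d: "0 < d" "d \<le> 1" "d * (4 * M) \<le> e"
    using e by (auto simp: d_def min_def field_simps)
  obtain p q where p: "\<forall>z\<in>S. cmod (g z - poly p z) < d" and q: "\<forall>z\<in>S. cmod (h z - poly q z) < d"
    using g h d(1) unfolding poly_approximable_def by meson
  have "cmod (g z * h z - poly (p * q) z) < e" if z: "z \<in> S" for z
  proof -
    have "cmod (poly q z) \<le> cmod (h z) + cmod (h z - poly q z)"
      by (metis norm_minus_commute norm_triangle_sub)
    also have "\<dots> \<le> M + 1"
      using q z B(2)[OF z] d(2) unfolding M_def by fastforce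
    finally have qM: "cmod (poly q z) \<le> 2 * M" using M by simp
    have gM: "cmod (g z) \<le> M" using B(1)[OF z] M by linarith
    have "g z * h z - poly (p * q) z = g z * (h z - poly q z) + (g z - poly p z) * poly q z"
      by (simp add: algebra_simps)
    then have "cmod (g z * h z - poly (p * q) z)
        \<le> cmod (g z) * cmod (h z - poly q z) + cmod (g z - poly p z) * cmod (poly q z)"
      by (metis norm_mult norm_triangle_ineq)
    also have "\<dots> \<le> M * d + d * (2 * M)"
      using p q z qM gM M d by (intro add_mono mult_mono) auto
    also have "\<dots> < d * (4 * M)" using M d by simp
    finally show ?thesis using d(3) by simp
  qed
  then show "\<exists>q. \<forall>z\<in>S. cmod (g z * h z - poly q z) < e" by blast
qed

lemma poly_approximable_power:
  assumes g: "poly_approximable S g" and B: "\<And>z. z \<in> S \<Longrightarrow> cmod (g z) \<le> B"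
  shows "poly_approximable S (\<lambda>z. g z ^ k)"
proof (induction k)
  case 0
  show ?case by (simp add: poly_approximable_const)
next
  case (Suc k)
  define M where "M = max 1 \<bar>B\<bar> ^ Suc k"
  have "cmod (g z) \<le> M" "cmod (g z ^ k) \<le> M" if "z \<in> S" for z
  proof -
    have b: "cmod (g z) \<le> max 1 \<bar>B\<bar>" using B[OF that] by linarith
    also have "\<dots> = max 1 \<bar>B\<bar> ^ 1" by simp
    also have "\<dots> \<le> M" unfolding M_def by (rule power_increasing) auto
    finally show "cmod (g z) \<le> M" .
    have "cmod (g z ^ k) \<le> max 1 \<bar>B\<bar> ^ k" using b by (simp add: norm_power power_mono)
    also have "\<dots> \<le> M" unfolding M_def by (rule power_increasing) auto
    finally show "cmod (g z ^ k) \<le> M" .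
  qed
  then show ?case using poly_approximable_mult[OF g Suc.IH, of M] by simp
qed

lemma poly_approximable_sum:
  assumes "\<And>k. k \<in> A \<Longrightarrow> poly_approximable S (g k)"
  shows "poly_approximable S (\<lambda>z. \<Sum>k\<in>A. g k z)"
  using assms
proof (induction A rule: infinite_finite_induct)
  case (insert a A)
  then show ?case by (simp add: poly_approximable_add)
qed (simp_all add: poly_approximable_const)

section \<open>Moving a pole to infinity\<close>

text \<open>Remainder of the geometric series. It is used with \<open>w = z\<close> for a far pole;
  for a short move of the pole, \<open>s - z\<close> takes the role of \<open>s\<close> and the
  displacement that of \<open>w\<close>.\<close>

lemma geometric_remainder:
  fixes w s :: complex
  assumes "w \<noteq> s" "s \<noteq> 0"
  shows "1 / (s - w) - (\<Sum>k<m. w ^ k / s ^ Suc k) = (w / s) ^ m / (s - w)"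
proof (induction m)
  case (Suc m)
  then have "1 / (s - w) - (\<Sum>k<Suc m. w ^ k / s ^ Suc k) = (w / s) ^ m / (s - w) - w ^ m / s ^ Suc m"
    by (simp add: algebra_simps)
  also have "\<dots> = (w / s) ^ Suc m / (s - w)"
    using assms by (simp add: divide_simps) (simp add: algebra_simps)
  finally show ?case .
qed simp

text \<open>Pole pushing: \<open>1/(s'-z)\<close> is a geometric series in \<open>1/(s-z)\<close> when \<open>s'\<close> is close to \<open>s\<close>.\<close>

lemma poly_approximable_pole_step:
  assumes ap: "poly_approximable S (\<lambda>z. 1 / (s - z))"
    and k: "0 < \<kappa>" "\<And>z. z \<in> S \<Longrightarrow> \<kappa> \<le> cmod (s - z)" "\<And>z. z \<in> S \<Longrightarrow> \<kappa> \<le> cmod (s' - z)"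
    and close: "cmod (s - s') \<le> \<kappa> / 2"
  shows "poly_approximable S (\<lambda>z. 1 / (s' - z))"
proof (rule poly_approximable_limit)
  fix e :: real assume "e > 0"
  then obtain m where m: "(1/2) ^ m < e * \<kappa>"
    using real_arch_pow_inv[of "e * \<kappa>" "1/2"] k(1) by auto
  \<comment> \<open>Truncated series in powers of \<open>1 / (s - z)\<close>. The constant
    coefficients are written as polynomials so that they count as approximable factors.\<close>
  define h where "h z = (\<Sum>i<m. (poly [:(s - s') ^ i:] z) * (1 / (s - z)) ^ Suc i)" for z
  have b: "cmod (1 / (s - z)) \<le> 1 / \<kappa>" if "z \<in> S" for z
    using k(1) k(2)[OF that] by (simp add: norm_divide frac_le)
  have "poly_approximable S h"
    unfolding h_def
  proof (intro poly_approximable_sum)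
    fix i
    define B where "B = max (cmod (s - s') ^ i) ((1 / \<kappa>) ^ Suc i)"
    have "cmod ((1 / (s - z)) ^ Suc i) \<le> B" if "z \<in> S" for z
      using power_mono[OF b[OF that], of "Suc i"] unfolding B_def norm_power by (simp add: le_max_iff_disj)
    then show "poly_approximable S (\<lambda>z. poly [:(s - s') ^ i:] z * (1 / (s - z)) ^ Suc i)"
      by (intro poly_approximable_mult[where B = B] poly_approximable_poly poly_approximable_power[OF ap b])
         (auto simp: B_def norm_power)
  qed
  moreover have "cmod (1 / (s' - z) - h z) < e" if z: "z \<in> S" for z
  proof -
    have nz: "s - z \<noteq> 0" "s' - z \<noteq> 0" using k z by force+
    have "1 / (s' - z) - h z = 1 / ((s - z) - (s - s')) - (\<Sum>i<m. (s - s') ^ i / (s - z) ^ Suc i)"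
      by (simp add: h_def divide_inverse power_inverse)
    also have "\<dots> = ((s - s') / (s - z)) ^ m / ((s - z) - (s - s'))"
      using nz by (intro geometric_remainder) auto
    finally have "cmod (1 / (s' - z) - h z) = (cmod (s - s') / cmod (s - z)) ^ m / cmod (s' - z)"
      by (simp add: norm_divide norm_power)
    also have "\<dots> \<le> (1/2) ^ m / \<kappa>"
    proof -
      have "cmod (s - s') / cmod (s - z) \<le> (\<kappa> / 2) / \<kappa>"
        using close k(1) k(2)[OF z] by (intro frac_le) auto
      then have r: "cmod (s - s') / cmod (s - z) \<le> 1/2" using k(1) by simp
      show ?thesis by (rule frac_le[OF _ power_mono[OF r] k(1) k(3)[OF z]]) simp_all
    qed
    also have "\<dots> < e" using m k(1) by (simp add: field_simps)
    finally show ?thesis .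
  qed
  ultimately show "\<exists>h. poly_approximable S h \<and> (\<forall>z\<in>S. cmod (1 / (s' - z) - h z) < e)" by blast
qed

text \<open>The starting point of pole pushing: |z / s| \<le> 1/2 on \<open>S\<close>, so the Taylor
  polynomials at 0 converge uniformly.\<close>

lemma poly_approximable_far_pole:
  assumes S: "\<And>z. z \<in> S \<Longrightarrow> cmod z \<le> M" and M: "0 < M" and s: "2 * M \<le> cmod s"
  shows "poly_approximable S (\<lambda>z. 1 / (s - z))"
proof (rule poly_approximable_limit)
  fix e :: real assume "e > 0"
  then obtain m where m: "(1/2) ^ m < e * M"
    using real_arch_pow_inv[of "e * M" "1/2"] M by auto
  define h where "h z = (\<Sum>i<m. poly (monom (1 / s ^ Suc i) i) z)" for z
  have "poly_approximable S h"
    unfolding h_def by (intro poly_approximable_sum poly_approximable_poly)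
  moreover have "cmod (1 / (s - z) - h z) < e" if z: "z \<in> S" for z
  proof -
    have far: "M \<le> cmod (s - z)" using norm_triangle_ineq2[of s z] S[OF z] s by linarith
    then have nz: "z \<noteq> s" "s \<noteq> 0" using M s by auto
    have "1 / (s - z) - h z = (z / s) ^ m / (s - z)"
      using geometric_remainder[OF nz, of m] by (simp add: h_def poly_monom)
    then have "cmod (1 / (s - z) - h z) = (cmod z / cmod s) ^ m / cmod (s - z)"
      by (simp add: norm_divide norm_power)
    also have "\<dots> \<le> (1/2) ^ m / M"
    proof -
      have "cmod z / cmod s \<le> M / (2 * M)"
        using S[OF z] M s by (intro frac_le) auto
      then have r: "cmod z / cmod s \<le> 1/2" using M by simp
      show ?thesis by (rule frac_le[OF _ power_mono[OF r] M far]) simp_all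
    qed
    also have "\<dots> < e" using m M by (simp add: field_simps)
    finally show ?thesis .
  qed
  ultimately show "\<exists>h. poly_approximable S h \<and> (\<forall>z\<in>S. cmod (1 / (s - z) - h z) < e)" by blast
qed

text \<open>A far pole is walked back along the real axis to \<open>s0\<close>. Every position keeps
  distance \<kappa> from \<open>S\<close> and every step has length at most \<kappa>/2, so
  \<open>poly_approximable_pole_step\<close> applies each time.\<close>

lemma poly_approximable_pole_on_ray:
  fixes s0 :: real
  assumes S: "\<And>z. z \<in> S \<Longrightarrow> cmod z \<le> M" and k: "0 < \<kappa>"
    and ray: "\<And>s z. s0 \<le> s \<Longrightarrow> z \<in> S \<Longrightarrow> \<kappa> \<le> cmod (complex_of_real s - z)"
  shows "poly_approximable S (\<lambda>z. 1 / (complex_of_real s0 - z))"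
proof -
  define M' where "M' = \<bar>M\<bar> + 1"
  \<comment> \<open>\<open>N\<close> steps to the right of \<open>s0\<close> the pole is beyond
    \<open>2 * M'\<close>, where \<open>poly_approximable_far_pole\<close> applies.\<close>
  obtain N :: nat where N: "2 * M' - s0 < of_nat N * (\<kappa> / 2)"
    using reals_Archimedean3[of "\<kappa> / 2"] k by (meson half_gt_zero)
  \<comment> \<open>\<open>j\<close> counts the steps taken back. Truncated subtraction leaves the
    pole at \<open>s0\<close> once \<open>j \<ge> N\<close>, so the induction carries no bound on
    \<open>j\<close>.\<close>
  have "poly_approximable S (\<lambda>z. 1 / (complex_of_real (s0 + real (N - j) * (\<kappa> / 2)) - z))" for j
  proof (induction j)
    case 0
    show ?case
    proof (rule poly_approximable_far_pole[of _ M'])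
      show "cmod z \<le> M'" if "z \<in> S" for z using S[OF that] by (simp add: M'_def)
      show "0 < M'" by (simp add: M'_def)
      show "2 * M' \<le> cmod (complex_of_real (s0 + real (N - 0) * (\<kappa> / 2)))"
        using N by (simp only: norm_of_real) simp
    qed
  next
    case (Suc j)
    show ?case
    proof (rule poly_approximable_pole_step[OF Suc.IH k])
      show "\<kappa> \<le> cmod (complex_of_real (s0 + real (N - j) * (\<kappa> / 2)) - z)"
        and "\<kappa> \<le> cmod (complex_of_real (s0 + real (N - Suc j) * (\<kappa> / 2)) - z)" if "z \<in> S" for z
        using k that by (intro ray; simp)+
      have "real (N - j) - real (N - Suc j) \<le> 1" "real (N - Suc j) \<le> real (N - j)"
        by linarith+
      then have "\<bar>real (N - j) - real (N - Suc j)\<bar> * (\<kappa> / 2) \<le> 1 * (\<kappa> / 2)"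
        using k by (intro mult_right_mono) auto
      moreover have "complex_of_real (s0 + real (N - j) * (\<kappa> / 2)) - complex_of_real (s0 + real (N - Suc j) * (\<kappa> / 2))
          = complex_of_real ((real (N - j) - real (N - Suc j)) * (\<kappa> / 2))"
        by (simp add: algebra_simps)
      moreover have "\<bar>(real (N - j) - real (N - Suc j)) * (\<kappa> / 2)\<bar> = \<bar>real (N - j) - real (N - Suc j)\<bar> * (\<kappa> / 2)"
        using k by (simp add: abs_mult)
      ultimately show "cmod (complex_of_real (s0 + real (N - j) * (\<kappa> / 2)) - complex_of_real (s0 + real (N - Suc j) * (\<kappa> / 2))) \<le> \<kappa> / 2"
        by (simp only: norm_of_real)
    qed
  qed
  from this[of N] show ?thesis by simp
qed

section \<open>Test functions and weak solutions\<close>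

lemma partial_x_separable:
  assumes "\<And>x. (k has_real_derivative k' x) (at x)"
  shows "partial_x (\<lambda>(x, y). complex_of_real (k x) * E y) = (\<lambda>(x, y). complex_of_real (k' x) * E y)"
proof -
  have "((\<lambda>s. complex_of_real (k s) * E y) has_vector_derivative complex_of_real (k' x) * E y) (at x)" for x y
    using assms[of x] by (intro has_vector_derivative_mult_left has_vector_derivative_of_real)
      (simp add: has_real_derivative_iff_has_vector_derivative)
  then show ?thesis
    by (auto simp: partial_x_def fun_eq_iff intro!: vector_derivative_at)
qed

lemma partial_y_separable:
  assumes "\<And>y. (E has_vector_derivative E' y) (at y)"
  shows "partial_y (\<lambda>(x, y). complex_of_real (k x) * E y) = (\<lambda>(x, y). complex_of_real (k x) * E' y)"
proof -
  have "((\<lambda>s. complex_of_real (k x) * E s) has_vector_derivative complex_of_real (k x) * E' y) (at y)" for x y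
    using assms[of y] by (intro has_vector_derivative_mult_right)
  then show ?thesis
    by (auto simp: partial_y_def fun_eq_iff intro!: vector_derivative_at)
qed

lemma C1_separable:
  assumes k: "\<And>x. (k has_real_derivative k' x) (at x)" and k': "continuous_on UNIV k'"
    and E: "\<And>y. (E has_vector_derivative E' y) (at y)" and E': "continuous_on UNIV E'"
  shows "C1 (\<lambda>(x, y). complex_of_real (k x) * E y)"
proof -
  have "continuous_on UNIV k" "continuous_on UNIV E"
    by (intro continuous_at_imp_continuous_on ballI DERIV_isCont[OF k] has_vector_derivative_continuous[OF E])+
  then have c: "continuous_on UNIV (\<lambda>z::real \<times> real. k (fst z))" "continuous_on UNIV (\<lambda>z::real \<times> real. k' (fst z))"
    "continuous_on UNIV (\<lambda>z::real \<times> real. E (snd z))" "continuous_on UNIV (\<lambda>z::real \<times> real. E' (snd z))"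
    using k' E' by (auto elim!: continuous_on_compose2 intro: continuous_on_fst continuous_on_snd continuous_on_id)
  have "(\<lambda>s. complex_of_real (k s) * E y) differentiable (at x)" for x y
  proof -
    have "((\<lambda>s. complex_of_real (k s) * E y) has_vector_derivative complex_of_real (k' x) * E y) (at x)"
      using k[of x] by (intro has_vector_derivative_mult_left has_vector_derivative_of_real)
        (simp add: has_real_derivative_iff_has_vector_derivative)
    then show ?thesis by (rule differentiableI_vector)
  qed
  moreover have "(\<lambda>s. complex_of_real (k x) * E s) differentiable (at y)" for x y
    by (rule differentiableI_vector[OF has_vector_derivative_mult_right[OF E]])
  ultimately show ?thesis
    unfolding C1_def partial_x_separable[OF k] partial_y_separable[OF E]
    using c by (auto simp: case_prod_unfold intro!: continuous_intros)
qed

lemma C2_separable: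
  assumes k: "\<And>x. (k has_real_derivative k' x) (at x)" "\<And>x. (k' has_real_derivative k'' x) (at x)"
    "continuous_on UNIV k''"
    and E: "\<And>y. (E has_vector_derivative E' y) (at y)" "\<And>y. (E' has_vector_derivative E'' y) (at y)"
    "continuous_on UNIV E''"
  shows "C2 (\<lambda>(x, y). complex_of_real (k x) * E y)"
    and "grushin_operator (\<lambda>(x, y). complex_of_real (k x) * E y) =
      (\<lambda>(x, y). complex_of_real (k'' x) * E y + complex_of_real (x\<^sup>2 * k x) * E'' y)"
proof -
  have "continuous_on UNIV k'" "continuous_on UNIV E'"
    by (intro continuous_at_imp_continuous_on ballI DERIV_isCont[OF k(2)] has_vector_derivative_continuous[OF E(2)])+
  then show "C2 (\<lambda>(x, y). complex_of_real (k x) * E y)"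
    unfolding C2_def partial_x_separable[OF k(1)] partial_y_separable[OF E(1)]
    using k E C1_separable by blast
  show "grushin_operator (\<lambda>(x, y). complex_of_real (k x) * E y) =
      (\<lambda>(x, y). complex_of_real (k'' x) * E y + complex_of_real (x\<^sup>2 * k x) * E'' y)"
    unfolding grushin_operator_def partial_x_separable[OF k(1)] partial_y_separable[OF E(1)]
      partial_x_separable[OF k(2)] partial_y_separable[OF E(2)]
    by (simp add: fun_eq_iff)
qed

section \<open>Square-integrable functions on sets of finite measure\<close>

lemma grushin_domain_borel [measurable]: "grushin_domain \<in> sets borel"
  unfolding grushin_domain_def by (intro borel_Times) auto

lemma grushin_domain_finite: "emeasure lborel grushin_domain < \<infinity>"
proof -
  have "bounded ({-1<..<1::real} \<times> {0..<2 * pi})"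
    by (intro bounded_Times) auto
  then show ?thesis unfolding grushin_domain_def by (rule emeasure_bounded_finite)
qed

text \<open>Stands in for the Cauchy-Schwarz inequality: integrated over a set of finite measure, it
  bounds an \<open>L\<^sup>1\<close> norm by a multiple of \<open>e\<close> plus a multiple of the
  squared \<open>L\<^sup>2\<close> norm.\<close>

lemma AM_GM_norm:
  fixes r :: real assumes "0 < e" "0 \<le> r"
  shows "r \<le> e + r\<^sup>2 / e"
proof -
  have "0 \<le> (r - e)\<^sup>2 + r * e" using assms by simp
  then have "r * e \<le> e * e + r * r" by (simp add: power2_eq_square algebra_simps)
  then show ?thesis using assms by (simp add: power2_eq_square field_simps)
qed

lemma square_integrable_on_imp_integrable:
  fixes g :: "'a::euclidean_space \<Rightarrow> complex"
  assumes g: "g square_integrable_on S" and S: "S \<in> sets borel" "emeasure lborel S < \<infinity>"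
  shows "set_integrable lborel S g"
proof -
  have 1: "set_integrable lborel S (\<lambda>z. 1 :: real)"
    using S by (simp add: set_integrable_def)
  have 2: "set_integrable lborel S (\<lambda>z. (cmod (g z))\<^sup>2)" and m: "set_borel_measurable lborel S g"
    using g by (auto simp: square_integrable_on_def)
  have "set_integrable lborel S (\<lambda>z. 1 + (cmod (g z))\<^sup>2)"
    by (rule set_integral_add(1)[OF 1 2])
  then show ?thesis
    by (rule set_integrable_bound)
       (use m AM_GM_norm[of 1] in auto)
qed

lemma square_integrable_on_diff:
  fixes g h :: "'a::euclidean_space \<Rightarrow> complex"
  assumes g: "g square_integrable_on S" and h: "h square_integrable_on S"
  shows "(\<lambda>z. g z - h z) square_integrable_on S"
proof -
  have m: "set_borel_measurable lborel S (\<lambda>z. g z - h z)"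
    using g h unfolding square_integrable_on_def set_borel_measurable_def
    by (simp only: scaleR_diff_right) (intro borel_measurable_diff, auto)
  have "set_integrable lborel S (\<lambda>z. 2 * (cmod (g z))\<^sup>2 + 2 * (cmod (h z))\<^sup>2)"
    using g h by (intro set_integral_add set_integrable_mult_right) (auto simp: square_integrable_on_def)
  moreover have "set_borel_measurable lborel S (\<lambda>z. (cmod (g z - h z))\<^sup>2)"
  proof -
    have "(\<lambda>z. (cmod (indicator S z *\<^sub>R (g z - h z)))\<^sup>2) \<in> borel_measurable lborel"
      using m unfolding set_borel_measurable_def by measurable
    moreover have "(cmod (indicator S z *\<^sub>R (g z - h z)))\<^sup>2 = indicator S z *\<^sub>R (cmod (g z - h z))\<^sup>2" for z
      by (simp add: indicator_def)
    ultimately show ?thesis unfolding set_borel_measurable_def by simp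
  qed
  moreover have "(cmod (g z - h z))\<^sup>2 \<le> 2 * (cmod (g z))\<^sup>2 + 2 * (cmod (h z))\<^sup>2" for z
  proof -
    have "(cmod (g z - h z))\<^sup>2 \<le> (cmod (g z) + cmod (h z))\<^sup>2"
      by (intro power_mono norm_triangle_ineq4) auto
    also have "\<dots> \<le> 2 * (cmod (g z))\<^sup>2 + 2 * (cmod (h z))\<^sup>2"
      using zero_le_power2[of "cmod (g z) - cmod (h z)"] by (simp add: power2_eq_square algebra_simps)
    finally show ?thesis .
  qed
  ultimately have "set_integrable lborel S (\<lambda>z. (cmod (g z - h z))\<^sup>2)"
    by (intro set_integrable_bound[where g = "\<lambda>z. (cmod (g z - h z))\<^sup>2"]) auto
  with m show ?thesis by (simp add: square_integrable_on_def)
qed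

text \<open>States are continuous in time in \<open>L\<^sup>2\<close>, while a pairing with a
  bounded wave is controlled by the \<open>L\<^sup>1\<close> norm.\<close>

lemma L2_convergence_imp_L1:
  fixes f :: "'t \<Rightarrow> 'a::euclidean_space \<Rightarrow> complex"
  assumes S: "S \<in> sets borel" "emeasure lborel S < \<infinity>"
    and sq: "eventually (\<lambda>t. f t square_integrable_on S) F" "g square_integrable_on S"
    and lim: "((\<lambda>t. LINT z:S|lborel. (cmod (f t z - g z))\<^sup>2) \<longlongrightarrow> 0) F"
  shows "((\<lambda>t. LINT z:S|lborel. cmod (f t z - g z)) \<longlongrightarrow> 0) F"
proof (rule tendstoI)
  fix e :: real assume e: "e > 0"
  define \<mu> where "\<mu> = measure lborel S"
  \<comment> \<open>Splits \<open>e\<close> evenly: the constant \<open>d\<close> integrates to at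
    most \<open>e / 2\<close> over \<open>S\<close>, and the squared norm is taken below
    \<open>d * (e / 2)\<close>.\<close>
  define d where "d = e / (2 * (\<mu> + 1))"
  have mu: "0 \<le> \<mu>" by (simp add: \<mu>_def)
  then have d: "0 < d" using e by (simp add: d_def)
  have "eventually (\<lambda>t. dist (LINT z:S|lborel. (cmod (f t z - g z))\<^sup>2) 0 < d * (e / 2)) F"
    using lim d e by (intro tendstoD) auto
  with sq(1) show "eventually (\<lambda>t. dist (LINT z:S|lborel. cmod (f t z - g z)) 0 < e) F"
  proof eventually_elim
    case (elim t)
    have diff: "(\<lambda>z. f t z - g z) square_integrable_on S"
      using elim sq(2) by (intro square_integrable_on_diff)
    have 1: "set_integrable lborel S (\<lambda>z. d)"
      using S by (simp add: set_integrable_def)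
    have 2: "set_integrable lborel S (\<lambda>z. (cmod (f t z - g z))\<^sup>2 / d)"
      using diff by (auto simp: square_integrable_on_def)
    have "(LINT z:S|lborel. cmod (f t z - g z)) \<le> (LINT z:S|lborel. d + (cmod (f t z - g z))\<^sup>2 / d)"
      using d square_integrable_on_imp_integrable[OF diff S] AM_GM_norm[of d]
      by (intro set_integral_mono set_integrable_norm set_integral_add 1 2) auto
    also have "\<dots> = (LINT z:S|lborel. d) + (LINT z:S|lborel. (cmod (f t z - g z))\<^sup>2) / d"
      using set_integral_add(2)[OF 1 2] by simp
    also have "(LINT z:S|lborel. d) = \<mu> * d"
      using S by (simp add: set_lebesgue_integral_def \<mu>_def)
    also have "(LINT z:S|lborel. (cmod (f t z - g z))\<^sup>2) / d < e / 2"
      using elim(2) d by (simp add: field_simps)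
    also have "\<mu> * d \<le> (\<mu> + 1) * d" using d by simp
    also have "(\<mu> + 1) * d = e / 2" using mu by (simp add: d_def field_simps)
    finally have "(LINT z:S|lborel. cmod (f t z - g z)) < e" by simp
    moreover have "0 \<le> (LINT z:S|lborel. cmod (f t z - g z))"
      by (simp add: set_lebesgue_integral_def)
    ultimately show ?case by simp
  qed
qed

section \<open>Integration by parts in time\<close>

text \<open>\<open>a (\<pi> p)\<close> is \<open>a T\<close> minus the integral of \<open>a'\<close>
  over \<open>{\<pi> p..T}\<close>, and Fubini exchanges the two integrals; \<open>U\<close> has
  only to be integrable. The time coordinate \<pi> is abstract in order to cover both functions of
  time alone and the control on time times space.\<close>

lemma weight_by_parts:
  fixes U :: "'a \<Rightarrow> complex" and a a' :: "real \<Rightarrow> real"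
  assumes M: "sigma_finite_measure M" and U: "integrable M U"
    and \<pi>: "\<pi> \<in> borel_measurable M" "\<And>p. U p \<noteq> 0 \<Longrightarrow> \<pi> p \<in> {0..T}"
    and a: "\<And>s. (a has_real_derivative a' s) (at s)" and a': "continuous_on UNIV a'"
  shows "(LINT p|M. complex_of_real (a (\<pi> p)) * U p) = complex_of_real (a T) * (LINT p|M. U p)
    - (LINT s:{0..T}|lborel. complex_of_real (a' s) * (LINT p|M. indicator {..s} (\<pi> p) * U p))"
proof -
  interpret M: sigma_finite_measure M by fact
  interpret pair_sigma_finite M "lborel :: real measure" ..
  note [measurable] = \<pi>(1) borel_measurable_integrable[OF U]
  have am [measurable]: "a' \<in> borel_measurable borel" "a \<in> borel_measurable borel"
    using a' a by (auto intro!: borel_measurable_continuous_onI continuous_at_imp_continuous_on DERIV_isCont)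
  \<comment> \<open>Integrating out \<open>s\<close> gives the increment of \<open>a\<close> from
    \<open>\<pi> p\<close> to \<open>T\<close>; integrating out \<open>p\<close> gives the running
    integral of \<open>U\<close> up to time \<open>s\<close>.\<close>
  define F where "F p s = indicator {0..T} s *\<^sub>R (complex_of_real (a' s) * (if \<pi> p \<le> s then U p else 0))" for p s
  have Fm: "case_prod F \<in> borel_measurable (M \<Otimes>\<^sub>M lborel)"
  proof -
    have [measurable]: "(\<lambda>x. U (fst x)) \<in> borel_measurable (M \<Otimes>\<^sub>M lborel)"
      "(\<lambda>x. \<pi> (fst x)) \<in> borel_measurable (M \<Otimes>\<^sub>M lborel)"
      "(\<lambda>x. snd x) \<in> borel_measurable (M \<Otimes>\<^sub>M (lborel :: real measure))"
      using measurable_compose[OF measurable_fst borel_measurable_integrable[OF U]]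
        measurable_compose[OF measurable_fst \<pi>(1)] by auto
    show ?thesis unfolding F_def case_prod_unfold by measurable
  qed
  obtain C where C: "\<And>s. s \<in> {0..T} \<Longrightarrow> \<bar>a' s\<bar> \<le> C" "0 \<le> C"
  proof -
    have "compact (a' ` {0..T})"
      using a' by (intro compact_continuous_image) (auto intro: continuous_on_subset)
    then obtain C where C: "\<forall>x\<in>a' ` {0..T}. norm x \<le> C" using compact_imp_bounded bounded_iff by metis
    have "\<bar>a' s\<bar> \<le> \<bar>C\<bar>" if "s \<in> {0..T}" for s
      using bspec[OF C imageI[OF that]] by simp
    then show thesis using that[of "\<bar>C\<bar>"] by simp
  qed
  have b1: "norm (F p s) \<le> indicator {0..T} s * (C * norm (U p))" for p s
    using C by (auto simp: F_def indicator_def norm_mult intro!: mult_mono)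
  have bI: "integrable lborel (\<lambda>s. indicator {0..T} s * (C * norm (U p)))" for p
  proof -
    have "integrable lborel (indicat_real {0..T})"
      by (rule integrable_real_indicator) (auto simp: emeasure_lborel_Icc_eq)
    then show ?thesis by simp
  qed
  have Fi: "integrable lborel (F p)" for p
  proof (rule Bochner_Integration.integrable_bound[OF bI[of p]])
    show "F p \<in> borel_measurable lborel" unfolding F_def by measurable
    show "AE s in lborel. norm (F p s) \<le> norm (indicator {0..T} s * (C * norm (U p)))"
      by (intro AE_I2) (use b1 in \<open>metis abs_ge_self order_trans real_norm_def\<close>)
  qed
  have "integrable M (\<lambda>p. LINT s|lborel. norm (case_prod F (p, s)))"
  proof (rule Bochner_Integration.integrable_bound)
    show "integrable M (\<lambda>p. \<bar>T\<bar> * C * norm (U p))" using U by simp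
    show "(\<lambda>p. LINT s|lborel. norm (case_prod F (p, s))) \<in> borel_measurable M"
      using Fm by measurable
    have le1: "(LINT s|lborel. norm (F p s)) \<le> (LINT s|lborel. indicator {0..T} s * (C * norm (U p)))" for p
      by (intro integral_mono bI integrable_norm Fi b1)
    have le2: "(LINT s|lborel. indicator {0..T} s * (C * norm (U p))) \<le> \<bar>T\<bar> * C * norm (U p)" for p
      using C(2) by (simp add: mult.assoc mult_right_mono)
    show "AE p in M. norm (LINT s|lborel. norm (case_prod F (p, s))) \<le> norm (\<bar>T\<bar> * C * norm (U p))"
    proof (intro AE_I2)
      fix p
      have "norm (LINT s|lborel. norm (case_prod F (p, s))) = (LINT s|lborel. norm (F p s))"
        by simp
      also have "\<dots> \<le> \<bar>T\<bar> * C * norm (U p)" using le1 le2 by (rule order_trans)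
      also have "\<dots> \<le> norm (\<bar>T\<bar> * C * norm (U p))" by simp
      finally show "norm (LINT s|lborel. norm (case_prod F (p, s))) \<le> norm (\<bar>T\<bar> * C * norm (U p))" .
    qed
  qed
  then have int: "integrable (M \<Otimes>\<^sub>M lborel) (case_prod F)"
    using Fm Fi by (intro Fubini_integrable) auto
  have inner: "(LINT s|lborel. F p s) = complex_of_real (a T - a (\<pi> p)) * U p" for p
  proof (cases "U p = 0")
    case False
    then have p: "\<pi> p \<in> {0..T}" by (rule \<pi>(2))
    have "F p s = (indicator {\<pi> p..T} s *\<^sub>R a' s) *\<^sub>R U p" for s
      using p by (auto simp: F_def indicator_def scaleR_conv_of_real)
    moreover have "integrable lborel (\<lambda>s. indicator {\<pi> p..T} s *\<^sub>R a' s)"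
      using borel_integrable_atLeastAtMost'[OF continuous_on_subset[OF a' subset_UNIV]]
      by (simp add: set_integrable_def)
    ultimately have "(LINT s|lborel. F p s) = (LINT s|lborel. indicator {\<pi> p..T} s *\<^sub>R a' s) *\<^sub>R U p"
      by (simp only: Bochner_Integration.integral_scaleR_left)
    also have "(LINT s|lborel. indicator {\<pi> p..T} s *\<^sub>R a' s) = a T - a (\<pi> p)"
      using p a a' by (intro integral_FTC_atLeastAtMost)
        (auto simp: has_real_derivative_iff_has_vector_derivative intro: has_vector_derivative_at_within continuous_on_subset)
    finally show ?thesis by (simp add: scaleR_conv_of_real)
  qed (simp add: F_def cong: if_cong)
  have aU: "integrable M (\<lambda>p. complex_of_real (a (\<pi> p)) * U p)"
  proof -
    have "integrable M (\<lambda>p. LINT s|lborel. F p s)" by (rule integrable_fst[OF int])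
    then have "integrable M (\<lambda>p. complex_of_real (a T) * U p - complex_of_real (a T - a (\<pi> p)) * U p)"
      unfolding inner using U by (intro Bochner_Integration.integrable_diff) auto
    then show ?thesis by (simp add: algebra_simps)
  qed
  have "(LINT s:{0..T}|lborel. complex_of_real (a' s) * (LINT p|M. indicator {..s} (\<pi> p) * U p))
      = (LINT s|lborel. LINT p|M. F p s)"
    unfolding F_def set_lebesgue_integral_def
    by (simp add: indicator_def of_bool_def if_distrib[of "\<lambda>c. c * _"] cong: if_cong)
  also have "\<dots> = (LINT p|M. LINT s|lborel. F p s)"
    by (rule Fubini_integral[OF int])
  also have "\<dots> = (LINT p|M. complex_of_real (a T) * U p - complex_of_real (a (\<pi> p)) * U p)"
    unfolding inner by (simp add: algebra_simps)
  also have "\<dots> = complex_of_real (a T) * (LINT p|M. U p) - (LINT p|M. complex_of_real (a (\<pi> p)) * U p)"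
    using U aU by simp
  finally show ?thesis by simp
qed

section \<open>Waves: modes times Fourier characters\<close>

text \<open>\<open>keyhole 0 (1/2)\<close> is the disc of radius 1/2. The multiplier estimate for
  the single monomial \<open>z ^ n\<close> is evaluated at \<open>z = 1/2\<close>, and
  \<open>(1/2) ^ n\<close> cancels.\<close>

lemma mode_le_1:
  assumes "\<bar>x\<bar> \<le> 1"
  shows "\<bar>mode n j x\<bar> \<le> 1"
proof -
  have b: "cmod (\<Sum>k\<in>{n}. (1::complex) * z ^ k) \<le> (1/2) ^ n" if "z \<in> keyhole 0 (1/2)" for z
    using that by (auto simp: keyhole_def norm_power intro!: power_mono)
  have "cmod (\<Sum>k\<in>{n}. (1::complex) * mode k j x * complex_of_real (1/2) ^ k) \<le> (1/2) ^ n"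
    by (rule mode_multiplier[where c = 0 and M = "1/2", OF _ b _ assms]) (auto simp: keyhole_def)
  then have "\<bar>mode n j x\<bar> * (1/2) ^ n \<le> 1 * (1/2) ^ n" by (simp add: norm_mult norm_power norm_divide)
  then show ?thesis using mult_le_cancel_right[of "\<bar>mode n j x\<bar>" "(1/2) ^ n" 1] by simp
qed

text \<open>The phase is centred at a point \<open>m\<close> of the removed segment, which turns the
  opening of the keyhole to the positive real axis. Frequencies are nonnegative, so combinations of
  waves are polynomials in one complex variable.\<close>

definition wave :: "real \<Rightarrow> nat \<Rightarrow> nat \<Rightarrow> real \<times> real \<Rightarrow> complex" where
  "wave m n j = (\<lambda>(x, y). complex_of_real (mode n j x) * cis (n * (y - m)))"

lemma cis_has_vector_derivative:
  "((\<lambda>y. cis (\<alpha> * (y - m))) has_vector_derivative complex_of_real \<alpha> * \<i> * cis (\<alpha> * (y - m))) (at y)"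
proof -
  have "((\<lambda>y. \<i> * complex_of_real (\<alpha> * (y - m))) has_vector_derivative \<i> * complex_of_real \<alpha>) (at y)"
    by (intro has_vector_derivative_mult_right has_vector_derivative_of_real)
       (auto intro!: derivative_eq_intros simp flip: has_real_derivative_iff_has_vector_derivative)
  from field_vector_diff_chain_at[OF this DERIV_exp]
  have "((\<lambda>y. exp (\<i> * complex_of_real (\<alpha> * (y - m)))) has_vector_derivative
      \<i> * complex_of_real \<alpha> * exp (\<i> * complex_of_real (\<alpha> * (y - m)))) (at y)"
    by (simp add: o_def)
  then show ?thesis by (simp add: cis_conv_exp mult.commute[of \<i>])
qed

text \<open>The term \<open>n^2 x^2\<close> of the second \<open>x\<close>-derivative cancels
  against \<open>x^2\<close> times the second \<open>y\<close>-derivative; what is left is one step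
  of the chain. The index is a successor because \<open>mode n 0\<close> does not vanish at
  \<open>x = -1, 1\<close>.\<close>

lemma wave_test_function: "dirichlet_test_function (wave m n (Suc j))"
  and grushin_operator_wave:
    "grushin_operator (wave m n (Suc j)) z = - of_nat n * wave m n (Suc j) z - exp (- real n) * wave m n j z"
proof -
  obtain k' k'' where k: "\<And>x. (mode n (Suc j) has_real_derivative k' x) (at x)"
    "\<And>x. (k' has_real_derivative k'' x) (at x)" "continuous_on UNIV k''"
    and k'': "\<And>x. k'' x = ((real n)\<^sup>2 * x\<^sup>2 - n) * mode n (Suc j) x - exp (- real n) * mode n j x"
    by (rule mode_derivatives[of n j]) blast
  define E where "E y = cis (real n * (y - m))" for y
  have Eeq: "E = (\<lambda>y. cis (real n * (y - m)))" by (rule ext) (simp add: E_def)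
  define E' where "E' y = complex_of_real n * \<i> * E y" for y
  define E'' where "E'' y = complex_of_real n * \<i> * E' y" for y
  have E: "(E has_vector_derivative E' y) (at y)" for y
    unfolding E'_def Eeq by (rule cis_has_vector_derivative)
  have E': "(E' has_vector_derivative E'' y) (at y)" for y
    unfolding E''_def E'_def[abs_def] by (intro has_vector_derivative_mult_right E[unfolded E'_def])
  have cE: "continuous_on UNIV E''"
    unfolding E''_def E'_def E_def by (intro continuous_intros)
  have w: "wave m n (Suc j) = (\<lambda>(x, y). complex_of_real (mode n (Suc j) x) * E y)"
    by (simp add: wave_def E_def)
  have "cis (real n * (y + 2 * pi - m)) = cis (real n * (y - m))" for y
  proof -
    have "cis (real n * (y + 2 * pi - m)) = cis (real n * (y - m)) * cis (2 * pi * real n)"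
      by (simp add: cis_mult algebra_simps)
    then show ?thesis by (simp add: cis_multiple_2pi)
  qed
  then show "dirichlet_test_function (wave m n (Suc j))"
    unfolding dirichlet_test_function_def using C2_separable(1)[OF k E E' cE]
    by (auto simp: w E_def mode_boundary)
  obtain x y where z: "z = (x, y)" by fastforce
  have "E'' y = - ((of_nat n)\<^sup>2 * E y)" by (simp add: E''_def E'_def power2_eq_square algebra_simps)
  then show "grushin_operator (wave m n (Suc j)) z = - of_nat n * wave m n (Suc j) z - exp (- real n) * wave m n j z"
    unfolding w C2_separable(2)[OF k E E' cE] z
    by (simp add: k'' wave_def E_def algebra_simps power2_eq_square)
qed

lemma wave_measurable [measurable]: "wave m n j \<in> borel_measurable borel"
proof -
  have "continuous_on UNIV (\<lambda>z::real \<times> real. mode n j (fst z))"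
    by (rule continuous_on_compose2[OF mode_continuous_on[of UNIV]]) (auto intro: continuous_on_fst continuous_on_id)
  then show ?thesis
    unfolding wave_def case_prod_unfold by (intro borel_measurable_continuous_onI continuous_intros)
qed

lemma wave_bounded: "z \<in> grushin_domain \<Longrightarrow> cmod (wave m n j z) \<le> 1"
  using mode_le_1[of "fst z" n j] by (auto simp: wave_def grushin_domain_def norm_mult)

lemma set_integrable_mult_bounded:
  fixes g w :: "'a::euclidean_space \<Rightarrow> complex"
  assumes g: "set_integrable lborel S g" and w: "w \<in> borel_measurable borel"
    and b: "\<And>z. z \<in> S \<Longrightarrow> cmod (w z) \<le> C"
  shows "set_integrable lborel S (\<lambda>z. g z * w z)"
    and "cmod (LINT z:S|lborel. g z * w z) \<le> (LINT z:S|lborel. cmod (g z)) * C"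
proof -
  have "set_integrable lborel S (\<lambda>z. complex_of_real C * g z)"
    using g by simp
  moreover have "(\<lambda>z. (indicator S z *\<^sub>R g z) * w z) \<in> borel_measurable lborel"
    using g w by (intro borel_measurable_times) (auto simp: set_integrable_def dest: borel_measurable_integrable)
  then have "set_borel_measurable lborel S (\<lambda>z. g z * w z)"
    by (simp add: set_borel_measurable_def)
  ultimately show i: "set_integrable lborel S (\<lambda>z. g z * w z)"
    by (rule set_integrable_bound)
       (use b in \<open>auto simp: norm_mult mult.commute[of "cmod (g _)"] intro!: AE_I2 mult_right_mono order_trans[OF b abs_ge_self]\<close>)
  have "cmod (LINT z:S|lborel. g z * w z) \<le> (LINT z:S|lborel. cmod (g z * w z))"
    using i by (rule set_integral_norm_bound)
  also have "\<dots> \<le> (LINT z:S|lborel. cmod (g z) * C)"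
    using i g b by (intro set_integral_mono set_integrable_norm set_integrable_mult_left)
      (auto simp: norm_mult intro: mult_left_mono)
  finally show "cmod (LINT z:S|lborel. g z * w z) \<le> (LINT z:S|lborel. cmod (g z)) * C" by simp
qed

section \<open>Time continuity of the state\<close>

context
  fixes f :: "real \<Rightarrow> real \<times> real \<Rightarrow> complex" and T :: real
  assumes sq: "\<And>t. t \<in> {0..T} \<Longrightarrow> f t square_integrable_on grushin_domain"
    and cont: "\<And>s. s \<in> {0..T} \<Longrightarrow>
        ((\<lambda>t. LINT z:grushin_domain|lborel. (cmod (f t z - f s z))\<^sup>2) \<longlongrightarrow> 0) (at s within {0..T})"
begin

lemma state_integrable: "t \<in> {0..T} \<Longrightarrow> set_integrable lborel grushin_domain (f t)"
  using square_integrable_on_imp_integrable[OF sq grushin_domain_borel grushin_domain_finite] .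

lemma state_L1_continuous:
  assumes "s \<in> {0..T}"
  shows "((\<lambda>t. LINT z:grushin_domain|lborel. cmod (f t z - f s z)) \<longlongrightarrow> 0) (at s within {0..T})"
  by (rule L2_convergence_imp_L1[OF grushin_domain_borel grushin_domain_finite _ sq[OF assms] cont[OF assms]])
     (auto simp: eventually_at_filter sq)

lemma state_pairing_continuous:
  assumes w: "w \<in> borel_measurable borel" and b: "\<And>z. z \<in> grushin_domain \<Longrightarrow> cmod (w z) \<le> 1"
  shows "continuous_on {0..T} (\<lambda>t. LINT z:grushin_domain|lborel. f t z * w z)"
  unfolding continuous_on_def
proof
  fix s assume s: "s \<in> {0..T}"
  show "((\<lambda>t. LINT z:grushin_domain|lborel. f t z * w z) \<longlongrightarrow> (LINT z:grushin_domain|lborel. f s z * w z))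
    (at s within {0..T})"
  proof (rule LIM_zero_cancel, rule Lim_null_comparison[OF _ state_L1_continuous[OF s]])
    have "cmod ((LINT z:grushin_domain|lborel. f t z * w z) - (LINT z:grushin_domain|lborel. f s z * w z))
        \<le> (LINT z:grushin_domain|lborel. cmod (f t z - f s z))" if t: "t \<in> {0..T}" for t
    proof -
      have "(LINT z:grushin_domain|lborel. f t z * w z) - (LINT z:grushin_domain|lborel. f s z * w z)
          = (LINT z:grushin_domain|lborel. f t z * w z - f s z * w z)"
        by (intro set_integral_diff(2)[symmetric] set_integrable_mult_bounded(1)[OF state_integrable w b] s t)
      also have "\<dots> = (LINT z:grushin_domain|lborel. (f t z - f s z) * w z)"
        by (simp add: algebra_simps)
      also have "cmod \<dots> \<le> (LINT z:grushin_domain|lborel. cmod (f t z - f s z)) * 1"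
        by (intro set_integrable_mult_bounded(2)[OF _ w b] set_integral_diff(1) state_integrable s t)
      finally show ?thesis by simp
    qed
    then show "\<forall>\<^sub>F t in at s within {0..T}.
        cmod ((LINT z:grushin_domain|lborel. f t z * w z) - (LINT z:grushin_domain|lborel. f s z * w z))
        \<le> (LINT z:grushin_domain|lborel. cmod (f t z - f s z))"
      by (auto simp: eventually_at_filter)
  qed
qed

text \<open>Continuity on the compact time interval. The uniform bound later controls the error term
  of the approximate adjoint solution.\<close>

lemma state_L1_bounded:
  obtains C where "\<And>t. t \<in> {0..T} \<Longrightarrow> (LINT z:grushin_domain|lborel. cmod (f t z)) \<le> C"
proof -
  have "continuous_on {0..T} (\<lambda>t. LINT z:grushin_domain|lborel. cmod (f t z))"
    unfolding continuous_on_def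
  proof
    fix s assume s: "s \<in> {0..T}"
    show "((\<lambda>t. LINT z:grushin_domain|lborel. cmod (f t z)) \<longlongrightarrow> (LINT z:grushin_domain|lborel. cmod (f s z)))
      (at s within {0..T})"
    proof (rule LIM_zero_cancel, rule Lim_null_comparison[OF _ state_L1_continuous[OF s]])
      have "norm ((LINT z:grushin_domain|lborel. cmod (f t z)) - (LINT z:grushin_domain|lborel. cmod (f s z)))
          \<le> (LINT z:grushin_domain|lborel. cmod (f t z - f s z))" if t: "t \<in> {0..T}" for t
      proof -
        have i: "set_integrable lborel grushin_domain (\<lambda>z. cmod (f t z) - cmod (f s z))"
          by (intro set_integral_diff(1) set_integrable_norm state_integrable s t)
        have "(LINT z:grushin_domain|lborel. cmod (f t z)) - (LINT z:grushin_domain|lborel. cmod (f s z))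
            = (LINT z:grushin_domain|lborel. cmod (f t z) - cmod (f s z))"
          by (intro set_integral_diff(2)[symmetric] set_integrable_norm state_integrable s t)
        also have "norm \<dots> \<le> (LINT z:grushin_domain|lborel. norm (cmod (f t z) - cmod (f s z)))"
          by (rule set_integral_norm_bound[OF i])
        also have "\<dots> \<le> (LINT z:grushin_domain|lborel. cmod (f t z - f s z))"
          by (intro set_integral_mono set_integrable_norm i set_integral_diff(1) state_integrable s t)
             (simp add: norm_triangle_ineq3)
        finally show ?thesis .
      qed
      then show "\<forall>\<^sub>F t in at s within {0..T}.
          norm ((LINT z:grushin_domain|lborel. cmod (f t z)) - (LINT z:grushin_domain|lborel. cmod (f s z)))
          \<le> (LINT z:grushin_domain|lborel. cmod (f t z - f s z))"
        by (auto simp: eventually_at_filter)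
    qed
  qed
  then have "compact ((\<lambda>t. LINT z:grushin_domain|lborel. cmod (f t z)) ` {0..T})"
    by (intro compact_continuous_image) auto
  then obtain C where C: "\<And>r. r \<in> (\<lambda>t. LINT z:grushin_domain|lborel. cmod (f t z)) ` {0..T} \<Longrightarrow> norm r \<le> C"
    using compact_imp_bounded bounded_iff by metis
  show thesis
    by (rule that[of C]) (use C[OF imageI] in fastforce)
qed

end

section \<open>Evolution against time-dependent weights\<close>

text \<open>The weak formulation has test functions constant in time; this passes to products
  \<open>a t * h z\<close>. Both source integrals are treated by \<open>weight_by_parts\<close>, and
  their running integrals add up to \<open>\<phi> - c\<close> by the evolution law.\<close>

lemma weighted_evolution:
  fixes \<phi> G :: "real \<Rightarrow> complex" and U :: "real \<times> 'b::euclidean_space \<Rightarrow> complex" and a a' :: "real \<Rightarrow> real"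
  assumes T: "0 \<le> T"
    and \<phi>: "continuous_on {0..T} \<phi>" and G: "continuous_on {0..T} G"
    and U: "set_integrable lborel ({0..T} \<times> A) U"
    and evol: "\<And>\<tau>. \<tau> \<in> {0..T} \<Longrightarrow>
      \<phi> \<tau> - c = (LINT t:{0..\<tau>}|lborel. G t) + (LINT p:{0..\<tau>} \<times> A|lborel. U p)"
    and a: "\<And>s. (a has_real_derivative a' s) (at s)" and a': "continuous_on UNIV a'"
  shows "complex_of_real (a T) * \<phi> T - complex_of_real (a 0) * c =
    (LINT t:{0..T}|lborel. complex_of_real (a' t) * \<phi> t + complex_of_real (a t) * G t)
    + (LINT p:{0..T} \<times> A|lborel. complex_of_real (a (fst p)) * U p)"
proof -
  have iG: "set_integrable lborel {0..T} G"
    using G by (simp add: borel_integrable_atLeastAtMost')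
  have ca: "continuous_on S a" for S
    by (intro continuous_at_imp_continuous_on ballI DERIV_isCont[OF a])
  have ca': "continuous_on S a'" for S
    using a' continuous_on_subset by blast
  define gG where "gG s = (LINT t:{0..s}|lborel. G t)" for s
  define gU where "gU s = (LINT p:{0..s} \<times> A|lborel. U p)" for s
  have 1: "(LINT t:{0..T}|lborel. complex_of_real (a t) * G t) = complex_of_real (a T) * gG T
      - (LINT s:{0..T}|lborel. complex_of_real (a' s) * gG s)"
  proof -
    have "(LINT t|lborel. indicator {..s} (id t) * (indicator {0..T} t *\<^sub>R G t)) = gG s" if "s \<in> {0..T}" for s
      unfolding gG_def set_lebesgue_integral_def
      by (rule Bochner_Integration.integral_cong) (use that in \<open>auto simp: indicator_def\<close>)
    then have "(LINT s:{0..T}|lborel. complex_of_real (a' s) * gG s)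
      = (LINT s:{0..T}|lborel. complex_of_real (a' s) * (LINT t|lborel. indicator {..s} (id t) * (indicator {0..T} t *\<^sub>R G t)))"
      by (intro set_lebesgue_integral_cong) auto
    moreover have "(LINT t|lborel. complex_of_real (a (id t)) * (indicator {0..T} t *\<^sub>R G t)) =
        complex_of_real (a T) * (LINT t|lborel. indicator {0..T} t *\<^sub>R G t)
        - (LINT s:{0..T}|lborel. complex_of_real (a' s) * (LINT t|lborel. indicator {..s} (id t) * (indicator {0..T} t *\<^sub>R G t)))"
      using iG by (intro weight_by_parts a a' lborel.sigma_finite_measure_axioms)
        (auto simp: set_integrable_def indicator_def id_def split: if_splits)
    ultimately show ?thesis
      by (simp add: set_lebesgue_integral_def gG_def id_def mult_scaleR_right)
  qed
  have 2: "(LINT p:{0..T} \<times> A|lborel. complex_of_real (a (fst p)) * U p) = complex_of_real (a T) * gU T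
      - (LINT s:{0..T}|lborel. complex_of_real (a' s) * gU s)"
  proof -
    have "(LINT p|lborel. indicator {..s} (fst p) * (indicator ({0..T} \<times> A) p *\<^sub>R U p)) = gU s" if "s \<in> {0..T}" for s
      unfolding gU_def set_lebesgue_integral_def
      by (rule Bochner_Integration.integral_cong) (use that in \<open>auto simp: indicator_def\<close>)
    then have "(LINT s:{0..T}|lborel. complex_of_real (a' s) * gU s)
      = (LINT s:{0..T}|lborel. complex_of_real (a' s) * (LINT p|lborel. indicator {..s} (fst p) * (indicator ({0..T} \<times> A) p *\<^sub>R U p)))"
      by (intro set_lebesgue_integral_cong) auto
    moreover have "(LINT p|lborel. complex_of_real (a (fst p)) * (indicator ({0..T} \<times> A) p *\<^sub>R U p)) =
        complex_of_real (a T) * (LINT p|lborel. indicator ({0..T} \<times> A) p *\<^sub>R U p)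
        - (LINT s:{0..T}|lborel. complex_of_real (a' s) * (LINT p|lborel. indicator {..s} (fst p) * (indicator ({0..T} \<times> A) p *\<^sub>R U p)))"
      using U by (intro weight_by_parts a a' lborel.sigma_finite_measure_axioms)
        (auto simp: set_integrable_def indicator_def split: if_splits
          intro!: borel_measurable_continuous_onI continuous_on_fst)
    ultimately show ?thesis
      by (simp add: set_lebesgue_integral_def gU_def mult_scaleR_right)
  qed
  have gG: "continuous_on {0..T} gG"
  proof -
    have "continuous_on {0..T} (\<lambda>s. integral {0..s} G)"
      using G by (intro indefinite_integral_continuous_1 integrable_continuous_real)
    moreover have "integral {0..s} G = gG s" if "s \<in> {0..T}" for s
      unfolding gG_def using that
      by (intro set_borel_integral_eq_integral(2)[symmetric] set_integrable_subset[OF iG]) auto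
    ultimately show ?thesis by (rule continuous_on_eq) simp
  qed
  \<comment> \<open>Continuity of \<open>gU\<close> is read off from the evolution law, \<phi> and
    \<open>gG\<close> being continuous; it gives the integrability required for splitting the
    integrals below.\<close>
  have gU_eq: "gU s = \<phi> s - c - gG s" if "s \<in> {0..T}" for s
    using evol[OF that] by (simp add: gU_def gG_def)
  have gU: "continuous_on {0..T} gU"
    by (rule continuous_on_eq[OF continuous_on_diff[OF continuous_on_diff[OF \<phi> continuous_on_const[of _ c]] gG]])
       (simp add: gU_eq)
  have I: "set_integrable lborel {0..T} h" if "continuous_on {0..T} h" for h :: "real \<Rightarrow> complex"
    using that by (simp add: borel_integrable_atLeastAtMost')
  have cI: "continuous_on {0..T} (\<lambda>s. complex_of_real (a' s) * g s)" if "continuous_on {0..T} g" for g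
    using that by (intro continuous_intros ca')
  have "(LINT s:{0..T}|lborel. complex_of_real (a' s) * gG s) + (LINT s:{0..T}|lborel. complex_of_real (a' s) * gU s)
      = (LINT s:{0..T}|lborel. complex_of_real (a' s) * gG s + complex_of_real (a' s) * gU s)"
    by (intro set_integral_add(2)[symmetric] I cI gG gU)
  also have "\<dots> = (LINT s:{0..T}|lborel. complex_of_real (a' s) * \<phi> s - complex_of_real (a' s) * c)"
    by (intro set_lebesgue_integral_cong) (auto simp: gU_eq algebra_simps)
  also have "\<dots> = (LINT s:{0..T}|lborel. complex_of_real (a' s) * \<phi> s) - (LINT s:{0..T}|lborel. complex_of_real (a' s) * c)"
    by (intro set_integral_diff(2) I cI \<phi> continuous_intros)
  also have "(LINT s:{0..T}|lborel. complex_of_real (a' s) * c) = complex_of_real (a T - a 0) * c"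
  proof -
    have "(LINT s|lborel. indicator {0..T} s *\<^sub>R a' s) = a T - a 0"
      using a ca' T by (intro integral_FTC_atLeastAtMost)
        (auto simp: has_real_derivative_iff_has_vector_derivative intro: has_vector_derivative_at_within)
    moreover have "(LINT s:{0..T}|lborel. complex_of_real (a' s) * c) = complex_of_real (LINT s:{0..T}|lborel. a' s) * c"
      by (simp add: set_integral_complex_of_real)
    ultimately show ?thesis by (simp add: set_lebesgue_integral_def)
  qed
  finally have 3: "(LINT s:{0..T}|lborel. complex_of_real (a' s) * gG s) + (LINT s:{0..T}|lborel. complex_of_real (a' s) * gU s)
    = (LINT s:{0..T}|lborel. complex_of_real (a' s) * \<phi> s) - complex_of_real (a T - a 0) * c" .
  have 4: "(LINT t:{0..T}|lborel. complex_of_real (a' t) * \<phi> t + complex_of_real (a t) * G t)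
    = (LINT t:{0..T}|lborel. complex_of_real (a' t) * \<phi> t) + (LINT t:{0..T}|lborel. complex_of_real (a t) * G t)"
    by (intro set_integral_add(2) I cI \<phi> continuous_intros ca G)
  have 5: "\<phi> T - c = gG T + gU T" using gU_eq[of T] T by simp
  have "complex_of_real (a T) * \<phi> T - complex_of_real (a 0) * c
    = complex_of_real (a T) * (gG T + gU T) + complex_of_real (a T - a 0) * c"
    unfolding 5[symmetric] by (simp add: algebra_simps)
  also have "\<dots> = (LINT t:{0..T}|lborel. complex_of_real (a' t) * \<phi> t + complex_of_real (a t) * G t)
    + (LINT p:{0..T} \<times> A|lborel. complex_of_real (a (fst p)) * U p)"
    unfolding 4 1 2 using 3 by (simp add: algebra_simps)
  finally show ?thesis .
qed

text \<open>The time coefficients of the approximate adjoint solution. The exponential is an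
  \<open>n\<close>-th power, so that it dilates the variable of a polynomial by
  \<open>exp (t - i)\<close>.\<close>

definition weight :: "nat \<Rightarrow> nat \<Rightarrow> real \<Rightarrow> real" where
  "weight n i t = exp (t - i) ^ n * t ^ i / fact i"

text \<open>By \<open>0 ^ 0 = 1\<close> the combination starts as the single wave of highest index,
  which yields the moment of the initial state.\<close>

lemma weight_0: "weight n i 0 = (if i = 0 then 1 else 0)"
  by (simp add: weight_def)

text \<open>Lowering \<open>i\<close> costs a factor \<open>exp (- n)\<close>, the same with which
  \<open>grushin_operator_wave\<close> lowers the index of the wave, and
  \<open>n * weight n i t\<close> offsets the \<open>- n\<close> of the operator. This match makes
  the sum in \<open>moment_identity\<close> telescope.\<close>

lemma weight_has_derivative:
  "(weight n i has_real_derivative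
    n * weight n i t + (if i = 0 then 0 else exp (- real n) * weight n (i - 1) t)) (at t)"
proof -
  have w: "weight n i = (\<lambda>t::real. exp (n * (t - i)) * (t ^ i / fact i))" for i :: nat
    by (simp add: weight_def fun_eq_iff exp_of_nat_mult)
  have e: "((\<lambda>t::real. exp (n * (t - i))) has_real_derivative n * exp (n * (t - i))) (at t)"
    by (auto intro!: derivative_eq_intros)
  have p: "((\<lambda>t. t ^ i / fact i) has_real_derivative (if i = 0 then 0 else t ^ (i - 1) / fact (i - 1))) (at t)"
  proof (cases i)
    case (Suc k)
    have "((\<lambda>t. t ^ i / fact i) has_real_derivative i * t ^ (i - 1) / fact i) (at t)"
      using DERIV_cdivide[OF DERIV_pow[of i t UNIV], of "fact i"] by simp
    then show ?thesis using Suc by (simp add: field_simps del: of_nat_Suc)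
  qed simp
  have s: "exp (n * (t - i)) = exp (- real n) * exp (n * (t - (i - 1)))" if "i \<noteq> 0"
    using that by (simp add: mult_exp_exp of_nat_diff algebra_simps)
  show ?thesis
    unfolding w by (rule DERIV_cong[OF DERIV_mult[OF e p]])
      (use s in \<open>auto simp: algebra_simps\<close>)
qed

lemma weight_continuous_on [continuous_intros]: "continuous_on S (weight n i)"
  by (intro continuous_at_imp_continuous_on ballI DERIV_isCont[OF weight_has_derivative])

lemma
  fixes g :: "'i \<Rightarrow> 'a \<Rightarrow> 'b::{banach, second_countable_topology}"
  assumes "\<And>i. i \<in> I \<Longrightarrow> set_integrable M A (g i)"
  shows set_integrable_sum: "set_integrable M A (\<lambda>x. \<Sum>i\<in>I. g i x)"
    and set_integral_sum: "(LINT x:A|M. \<Sum>i\<in>I. g i x) = (\<Sum>i\<in>I. LINT x:A|M. g i x)"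
  using assms
  by (auto simp: set_integrable_def set_lebesgue_integral_def scaleR_sum_right)

section \<open>Moments of a null-controlled initial state\<close>

locale controlled_solution =
  fixes \<omega> T f0 u f
  assumes solution: "grushin_solution \<omega> T f0 u f"
    and T: "0 \<le> T"
    and control: "u square_integrable_on ({0..T} \<times> (\<omega> \<inter> grushin_domain))"
    and \<omega>: "\<omega> \<inter> grushin_domain \<in> sets borel"
    and null: "AE z\<in>grushin_domain in lborel. f T z = 0"
begin

lemma state_square_integrable: "t \<in> {0..T} \<Longrightarrow> f t square_integrable_on grushin_domain"
  and state_continuous: "s \<in> {0..T} \<Longrightarrow>
    ((\<lambda>t. LINT z:grushin_domain|lborel. (cmod (f t z - f s z))\<^sup>2) \<longlongrightarrow> 0) (at s within {0..T})"
  using solution by (auto simp: grushin_solution_def)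

lemma evolution:
  assumes "dirichlet_test_function h" "\<tau> \<in> {0..T}"
  shows "(LINT z:grushin_domain|lborel. f \<tau> z * h z) - (LINT z:grushin_domain|lborel. f0 z * h z)
    = (LINT t:{0..\<tau>}|lborel. LINT z:grushin_domain|lborel. f t z * grushin_operator h z)
      + (LINT p:{0..\<tau>} \<times> (\<omega> \<inter> grushin_domain)|lborel. u p * h (snd p))"
  using solution assms unfolding grushin_solution_def by (simp add: case_prod_unfold)

lemma control_integrable: "set_integrable lborel ({0..T} \<times> (\<omega> \<inter> grushin_domain)) u"
proof (rule square_integrable_on_imp_integrable[OF control])
  show "{0..T} \<times> (\<omega> \<inter> grushin_domain) \<in> sets borel"
    using \<omega> by (intro borel_Times) auto
  have "bounded ({0..T} \<times> ({-1<..<1::real} \<times> {0..<2 * pi}))"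
    by (intro bounded_Times) auto
  then have "bounded ({0..T} \<times> (\<omega> \<inter> grushin_domain))"
    by (rule bounded_subset) (auto simp: grushin_domain_def)
  then show "emeasure lborel ({0..T} \<times> (\<omega> \<inter> grushin_domain)) < \<infinity>"
    by (rule emeasure_bounded_finite)
qed

lemma snd_measurable:
  assumes "w \<in> borel_measurable borel"
  shows "(\<lambda>p :: real \<times> real \<times> real. w (snd p)) \<in> borel_measurable borel"
  by (rule measurable_compose[OF _ assms]) (intro borel_measurable_continuous_onI continuous_on_snd continuous_on_id)

text \<open>The solution is tested with the sum over \<open>i \<le> l\<close> of
  \<open>weight n i t\<close> times the wave of index \<open>Suc l - i\<close>. The zero final state
  removes the term at time \<open>T\<close> and the interior terms telescope. Besides the control
  only the wave of index 0 remains; its coefficient has the exponential factor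
  \<open>exp (n (t - l - 1))\<close>.\<close>

lemma moment_identity:
  "(LINT z:grushin_domain|lborel. f0 z * wave m n (Suc l) z) =
    (LINT t:{0..T}|lborel. complex_of_real (exp (- real n) * weight n l t) * (LINT z:grushin_domain|lborel. f t z * wave m n 0 z))
    - (LINT p:{0..T} \<times> (\<omega> \<inter> grushin_domain)|lborel.
        u p * (\<Sum>i<Suc l. complex_of_real (weight n i (fst p)) * wave m n (Suc l - i) (snd p)))"
proof -
  define \<phi> where "\<phi> j t = (LINT z:grushin_domain|lborel. f t z * wave m n j z)" for j t
  define c0 where "c0 j = (LINT z:grushin_domain|lborel. f0 z * wave m n j z)" for j
  define A where "A = \<omega> \<inter> grushin_domain"
  define G where "G j t = - of_nat n * \<phi> (Suc j) t - exp (- real n) * \<phi> j t" for j t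
  define U where "U j p = u p * wave m n j (snd p)" for j p
  \<comment> \<open>\<open>e i\<close> arises twice: from differentiating \<open>t ^ i\<close> in
    the \<open>i\<close>-th weight, and, with opposite sign, from the operator at
    \<open>i - 1\<close>. The value 0 at \<open>i = 0\<close> starts the telescope; at
    \<open>Suc l\<close> the wave index has come down to 0.\<close>
  define e where "e i t = (if i = 0 then 0 else complex_of_real (exp (- real n) * weight n (i - 1) t) * \<phi> (Suc l - i) t)" for i t
  have c\<phi>: "continuous_on {0..T} (\<phi> j)" for j
    unfolding \<phi>_def
    by (rule state_pairing_continuous[OF state_square_integrable state_continuous wave_measurable wave_bounded])
  have iU: "set_integrable lborel ({0..T} \<times> A) (U j)" for j
    unfolding U_def A_def
    by (rule set_integrable_mult_bounded(1)[OF control_integrable snd_measurable[OF wave_measurable], where C = 1])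
       (auto intro: wave_bounded)
  have \<phi>T: "\<phi> j T = 0" for j
  proof -
    have "\<phi> j T = (LINT z:grushin_domain|lborel. 0)"
      unfolding \<phi>_def set_lebesgue_integral_def
    proof (rule integral_cong_AE)
      have "set_integrable lborel grushin_domain (\<lambda>z. f T z * wave m n j z)"
        by (rule set_integrable_mult_bounded(1)[OF state_integrable[OF state_square_integrable state_continuous] wave_measurable wave_bounded])
           (use T in auto)
      then show "(\<lambda>z. indicator grushin_domain z *\<^sub>R (f T z * wave m n j z)) \<in> borel_measurable lborel"
        by (auto simp: set_integrable_def dest: borel_measurable_integrable)
      show "AE z in lborel. indicator grushin_domain z *\<^sub>R (f T z * wave m n j z) = indicator grushin_domain z *\<^sub>R 0"
        using null by eventually_elim (auto simp: indicator_def)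
    qed auto
    then show ?thesis by simp
  qed
  have ev: "\<phi> (Suc j) \<tau> - c0 (Suc j) = (LINT t:{0..\<tau>}|lborel. G j t) + (LINT p:{0..\<tau>} \<times> A|lborel. U (Suc j) p)"
    if \<tau>: "\<tau> \<in> {0..T}" for j \<tau>
  proof -
    have "(LINT z:grushin_domain|lborel. f t z * grushin_operator (wave m n (Suc j)) z) = G j t" if "t \<in> {0..\<tau>}" for t
    proof -
      have i: "set_integrable lborel grushin_domain (\<lambda>z. f t z * wave m n j z)" for j
        by (rule set_integrable_mult_bounded(1)[OF state_integrable[OF state_square_integrable state_continuous] wave_measurable wave_bounded])
           (use that \<tau> in auto)
      have "(LINT z:grushin_domain|lborel. f t z * grushin_operator (wave m n (Suc j)) z)
        = (LINT z:grushin_domain|lborel. - of_nat n * (f t z * wave m n (Suc j) z) - exp (- real n) * (f t z * wave m n j z))"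
        by (simp add: grushin_operator_wave algebra_simps)
      also have "\<dots> = (LINT z:grushin_domain|lborel. - of_nat n * (f t z * wave m n (Suc j) z))
          - (LINT z:grushin_domain|lborel. exp (- real n) * (f t z * wave m n j z))"
        by (intro set_integral_diff(2) set_integrable_mult_right i)
      finally show ?thesis by (simp only: G_def \<phi>_def set_integral_mult_right)
    qed
    then have "(LINT t:{0..\<tau>}|lborel. LINT z:grushin_domain|lborel. f t z * grushin_operator (wave m n (Suc j)) z)
        = (LINT t:{0..\<tau>}|lborel. G j t)"
      by (intro set_lebesgue_integral_cong) auto
    then show ?thesis
      using evolution[OF wave_test_function \<tau>, of m n j] by (simp add: \<phi>_def c0_def U_def A_def)
  qed
  \<comment> \<open>\<open>Suc (l - i)\<close> is \<open>Suc l - i\<close> for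
    \<open>i \<le> l\<close>, in the form that exhibits the wave as a test function.\<close>
  have step: "- complex_of_real (weight n i 0) * c0 (Suc (l - i)) =
      (LINT t:{0..T}|lborel. e i t - e (Suc i) t)
      + (LINT p:{0..T} \<times> A|lborel. complex_of_real (weight n i (fst p)) * U (Suc (l - i)) p)"
    if i: "i < Suc l" for i
  proof -
    let ?a' = "\<lambda>t. n * weight n i t + (if i = 0 then 0 else exp (- real n) * weight n (i - 1) t)"
    have cG: "continuous_on {0..T} (G j)" for j
      unfolding G_def by (intro continuous_intros c\<phi>)
    have "continuous_on UNIV ?a'"
      by (cases "i = 0") (auto intro!: continuous_intros)
    from weighted_evolution[OF T c\<phi> cG iU ev weight_has_derivative this]
    have "complex_of_real (weight n i T) * \<phi> (Suc (l - i)) T - complex_of_real (weight n i 0) * c0 (Suc (l - i)) =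
      (LINT t:{0..T}|lborel. complex_of_real (?a' t) * \<phi> (Suc (l - i)) t + complex_of_real (weight n i t) * G (l - i) t)
      + (LINT p:{0..T} \<times> A|lborel. complex_of_real (weight n i (fst p)) * U (Suc (l - i)) p)"
      by simp
    moreover have "complex_of_real (?a' t) * \<phi> (Suc (l - i)) t + complex_of_real (weight n i t) * G (l - i) t
      = e i t - e (Suc i) t" for t
      using i by (auto simp: G_def e_def Suc_diff_le algebra_simps)
    ultimately show ?thesis using \<phi>T by simp
  qed
  have ce: "continuous_on {0..T} (e i)" for i
  proof (cases "i = 0")
    case True
    then have "e i = (\<lambda>t. 0)" by (simp add: e_def fun_eq_iff)
    then show ?thesis by simp
  next
    case False
    then have "e i = (\<lambda>t. complex_of_real (exp (- real n) * weight n (i - 1) t) * \<phi> (Suc l - i) t)"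
      by (simp add: e_def fun_eq_iff)
    then show ?thesis by (auto intro!: continuous_intros c\<phi>)
  qed
  have "(\<Sum>i<Suc l. - complex_of_real (weight n i 0) * c0 (Suc (l - i)))
    = (\<Sum>i<Suc l. LINT t:{0..T}|lborel. e i t - e (Suc i) t)
      + (\<Sum>i<Suc l. LINT p:{0..T} \<times> A|lborel. complex_of_real (weight n i (fst p)) * U (Suc (l - i)) p)"
    using step by (simp add: sum.distrib[symmetric])
  also have "(\<Sum>i<Suc l. - complex_of_real (weight n i 0) * c0 (Suc (l - i))) = - c0 (Suc l)"
    unfolding sum.lessThan_Suc_shift by (simp add: weight_0)
  also have "(\<Sum>i<Suc l. LINT t:{0..T}|lborel. e i t - e (Suc i) t) = (LINT t:{0..T}|lborel. \<Sum>i<Suc l. e i t - e (Suc i) t)"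
    by (intro set_integral_sum[symmetric] borel_integrable_atLeastAtMost' continuous_intros ce)
  also have "(\<lambda>t. \<Sum>i<Suc l. e i t - e (Suc i) t) = (\<lambda>t. - e (Suc l) t)"
  proof
    fix t
    have "e 0 t = 0" by (simp add: e_def)
    then show "(\<Sum>i<Suc l. e i t - e (Suc i) t) = - e (Suc l) t"
      using sum_lessThan_telescope'[of "\<lambda>i. e i t" "Suc l"] by simp
  qed
  also have "(\<Sum>i<Suc l. LINT p:{0..T} \<times> A|lborel. complex_of_real (weight n i (fst p)) * U (Suc (l - i)) p)
    = (LINT p:{0..T} \<times> A|lborel. \<Sum>i<Suc l. complex_of_real (weight n i (fst p)) * U (Suc (l - i)) p)"
  proof (intro set_integral_sum[symmetric])
    fix i assume "i \<in> {..<Suc l}"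
    have "compact (weight n i ` {0..T})"
      by (intro compact_continuous_image weight_continuous_on) auto
    then obtain C where C: "\<forall>x\<in>weight n i ` {0..T}. norm x \<le> C" using compact_imp_bounded bounded_iff by metis
    have m: "(\<lambda>p :: real \<times> real \<times> real. complex_of_real (weight n i (fst p))) \<in> borel_measurable borel"
      by (intro borel_measurable_continuous_onI continuous_intros
        continuous_on_compose2[OF weight_continuous_on[of UNIV]] continuous_on_fst continuous_on_id) auto
    have "set_integrable lborel ({0..T} \<times> A) (\<lambda>p. U (Suc (l - i)) p * complex_of_real (weight n i (fst p)))"
      by (rule set_integrable_mult_bounded(1)[OF iU m, where C = C]) (use C in auto)
    then show "set_integrable lborel ({0..T} \<times> A) (\<lambda>p. complex_of_real (weight n i (fst p)) * U (Suc (l - i)) p)"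
      by (simp add: mult.commute)
  qed
  finally have "c0 (Suc l) = (LINT t:{0..T}|lborel. e (Suc l) t)
    - (LINT p:{0..T} \<times> A|lborel. \<Sum>i<Suc l. complex_of_real (weight n i (fst p)) * U (Suc (l - i)) p)"
    by (simp add: set_lebesgue_integral_def algebra_simps)
  moreover have "(\<Sum>i<Suc l. complex_of_real (weight n i (fst p)) * U (Suc (l - i)) p)
      = u p * (\<Sum>i<Suc l. complex_of_real (weight n i (fst p)) * wave m n (Suc l - i) (snd p))" for p
    unfolding sum_distrib_left by (intro sum.cong refl) (auto simp: U_def Suc_diff_le algebra_simps)
  ultimately show ?thesis by (simp add: c0_def e_def \<phi>_def A_def)
qed

text \<open>After insertion of \<open>moment_identity\<close> and exchange of sums and integrals,
  each integrand contains the polynomial with coefficients multiplied by modes, at a point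
  \<open>exp (t - i) * cis (y - m)\<close>; \<open>mode_multiplier\<close> bounds it by
  \<open>B\<close>. The constant involves the state, the control, \<open>T\<close> and
  \<open>l\<close>, and is fixed before the polynomial.\<close>

lemma observability_bound:
  assumes c: "\<And>x y. (x, y) \<in> \<omega> \<Longrightarrow> cos (y - m) \<le> c" and l: "T \<le> l"
  obtains C where "\<And>S (p :: nat \<Rightarrow> complex) B. finite S \<Longrightarrow>
      (\<And>z. z \<in> keyhole c (exp T) \<Longrightarrow> cmod (\<Sum>n\<in>S. p n * z ^ n) \<le> B) \<Longrightarrow>
      cmod (\<Sum>n\<in>S. p n * (LINT z:grushin_domain|lborel. f0 z * wave m n (Suc l) z)) \<le> C * B"
proof -
  let ?A = "{0..T} \<times> (\<omega> \<inter> grushin_domain)"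
  obtain Cf where Cf: "\<And>t. t \<in> {0..T} \<Longrightarrow> (LINT z:grushin_domain|lborel. cmod (f t z)) \<le> Cf"
    by (rule state_L1_bounded[of T f]) (use state_square_integrable state_continuous in blast)+
  define Cu where "Cu = (LINT p:?A|lborel. cmod (u p))"
  define E where "E = (\<Sum>i<Suc l. T ^ i / fact i)"
  have Cu: "0 \<le> Cu" by (simp add: Cu_def set_lebesgue_integral_def)
  show thesis
  proof (rule that)
    fix S :: "nat set" and p :: "nat \<Rightarrow> complex" and B :: real
    assume S: "finite S" and pB: "\<And>z. z \<in> keyhole c (exp T) \<Longrightarrow> cmod (\<Sum>n\<in>S. p n * z ^ n) \<le> B"
    have B: "0 \<le> B"
      by (rule order_trans[OF norm_ge_zero pB[of 0]]) (simp add: keyhole_def)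
    \<comment> \<open>Reads a sum of waves as a polynomial at \<open>r * cis (y - m)\<close>; the
      powers of \<open>r\<close> will come from the weights.\<close>
    have multiplier: "cmod (\<Sum>n\<in>S. p n * (complex_of_real (r ^ n) * wave m n j (x, y))) \<le> B"
      if "complex_of_real r * cis (y - m) \<in> keyhole c (exp T)" "(x, y) \<in> grushin_domain" for r x y j
    proof -
      have "(\<Sum>n\<in>S. p n * (complex_of_real (r ^ n) * wave m n j (x, y)))
        = (\<Sum>n\<in>S. p n * mode n j x * (complex_of_real r * cis (y - m)) ^ n)"
        by (intro sum.cong refl) (simp add: wave_def power_mult_distrib Complex.DeMoivre)
      then show ?thesis
        using mode_multiplier[OF S pB that(1)] that(2) by (auto simp: grushin_domain_def)
    qed
    define W where "W n t = complex_of_real (exp (- real n) * weight n l t)" for n t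
    define \<phi> where "\<phi> n t = (LINT z:grushin_domain|lborel. f t z * wave m n 0 z)" for n t
    have c\<phi>: "continuous_on {0..T} (\<phi> n)" for n
      unfolding \<phi>_def
      by (rule state_pairing_continuous[OF state_square_integrable state_continuous wave_measurable wave_bounded])
    have iW: "set_integrable lborel {0..T} (\<lambda>t. p n * (W n t * \<phi> n t))" for n
      unfolding W_def by (intro borel_integrable_atLeastAtMost' continuous_intros c\<phi>)
    have W: "cmod (\<Sum>n\<in>S. p n * (W n t * wave m n 0 z)) \<le> T ^ l / fact l * B"
      if t: "t \<in> {0..T}" and z: "z \<in> grushin_domain" for t z
    proof -
      obtain x y where xy: "z = (x, y)" by fastforce
      \<comment> \<open>The additional \<open>exp (- n)\<close> turns \<open>t - l\<close> into
        \<open>t - Suc l\<close>.\<close>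
      have "W n t = complex_of_real (t ^ l / fact l) * complex_of_real (exp (t - Suc l) ^ n)" for n
      proof -
        have "exp (- real n) * exp (t - l) ^ n = exp (t - Suc l) ^ n"
          by (simp add: exp_of_nat_mult[symmetric] mult_exp_exp algebra_simps)
        then show ?thesis by (simp add: W_def weight_def flip: of_real_mult of_real_power)
      qed
      then have "(\<Sum>n\<in>S. p n * (W n t * wave m n 0 z))
        = complex_of_real (t ^ l / fact l) * (\<Sum>n\<in>S. p n * (complex_of_real (exp (t - Suc l) ^ n) * wave m n 0 (x, y)))"
        unfolding sum_distrib_left xy by (intro sum.cong refl) (simp only: mult_ac)
      then have "cmod (\<Sum>n\<in>S. p n * (W n t * wave m n 0 z))
        = t ^ l / fact l * cmod (\<Sum>n\<in>S. p n * (complex_of_real (exp (t - Suc l) ^ n) * wave m n 0 (x, y)))"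
        using t by (simp only: norm_mult norm_of_real) simp
      also have "\<dots> \<le> T ^ l / fact l * B"
      proof (intro mult_mono multiplier)
        \<comment> \<open>Here \<open>T \<le> l\<close> enters: the modulus is at most
          \<open>exp (- 1)\<close>, so the point is in the small disc whatever the angle, also over
          the removed segment.\<close>
        have "exp (t - Suc l) \<le> exp (- 1)" using t l by simp
        also have "exp (- 1 :: real) \<le> 1 / 2"
          using exp_ge_add_one_self[of 1] by (simp add: exp_minus field_simps)
        finally show "complex_of_real (exp (t - Suc l)) * cis (y - m) \<in> keyhole c (exp T)"
          by (simp add: keyhole_def norm_mult)
        show "t ^ l / fact l \<le> T ^ l / fact l"
          using t by (intro divide_right_mono power_mono) auto
      qed (use z xy t T B in auto)
      finally show ?thesis .
    qed
    have first: "cmod (\<Sum>n\<in>S. p n * (LINT t:{0..T}|lborel. W n t * \<phi> n t)) \<le> T * (Cf * (T ^ l / fact l * B))"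
    proof -
      have "(\<Sum>n\<in>S. p n * (LINT t:{0..T}|lborel. W n t * \<phi> n t))
          = (LINT t:{0..T}|lborel. \<Sum>n\<in>S. p n * (W n t * \<phi> n t))"
        by (simp add: set_integral_sum[OF iW])
      also have "cmod \<dots> \<le> (LINT t:{0..T}|lborel. cmod (\<Sum>n\<in>S. p n * (W n t * \<phi> n t)))"
        by (intro set_integral_norm_bound set_integrable_sum iW)
      also have "\<dots> \<le> (LINT t:{0..T}|lborel. Cf * (T ^ l / fact l * B))"
      proof (intro set_integral_mono set_integrable_norm set_integrable_sum iW)
        show "set_integrable lborel {0..T} (\<lambda>t. Cf * (T ^ l / fact l * B))"
          by (intro borel_integrable_atLeastAtMost' continuous_intros)
        fix t assume t: "t \<in> {0..T}"
        have sf: "set_integrable lborel grushin_domain (f t)"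
          by (rule state_integrable[OF state_square_integrable state_continuous t])
        have i: "set_integrable lborel grushin_domain (\<lambda>z. p n * W n t * (f t z * wave m n 0 z))" for n
          by (intro set_integrable_mult_right set_integrable_mult_bounded(1)[OF sf wave_measurable wave_bounded])
        have "(\<Sum>n\<in>S. p n * (W n t * \<phi> n t)) = (LINT z:grushin_domain|lborel. \<Sum>n\<in>S. p n * W n t * (f t z * wave m n 0 z))"
          unfolding set_integral_sum[OF i] \<phi>_def by (simp add: mult.assoc)
        also have "(\<lambda>z. \<Sum>n\<in>S. p n * W n t * (f t z * wave m n 0 z)) = (\<lambda>z. f t z * (\<Sum>n\<in>S. p n * (W n t * wave m n 0 z)))"
          by (simp add: sum_distrib_left mult_ac)
        finally have "cmod (\<Sum>n\<in>S. p n * (W n t * \<phi> n t)) \<le> (LINT z:grushin_domain|lborel. cmod (f t z)) * (T ^ l / fact l * B)"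
          using set_integrable_mult_bounded(2)[OF sf _ W[OF t]] by simp
        also have "\<dots> \<le> Cf * (T ^ l / fact l * B)"
          using Cf[OF t] B T by (intro mult_right_mono) auto
        finally show "cmod (\<Sum>n\<in>S. p n * (W n t * \<phi> n t)) \<le> Cf * (T ^ l / fact l * B)" .
      qed
      also have "\<dots> = T * (Cf * (T ^ l / fact l * B))"
        using T by (simp add: set_lebesgue_integral_def)
      finally show ?thesis .
    qed
    define V where "V n q = (\<Sum>i<Suc l. complex_of_real (weight n i (fst q)) * wave m n (Suc l - i) (snd q))" for n q
    have wm: "(\<lambda>q :: real \<times> real \<times> real. complex_of_real (weight n i (fst q))) \<in> borel_measurable borel" for n i
      by (intro borel_measurable_continuous_onI continuous_intros
        continuous_on_compose2[OF weight_continuous_on[of UNIV]] continuous_on_fst continuous_on_id) auto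
    have Vm: "V n \<in> borel_measurable borel" for n
      unfolding V_def by (intro borel_measurable_sum borel_measurable_times wm snd_measurable wave_measurable)
    have V: "cmod (\<Sum>n\<in>S. p n * V n q) \<le> E * B" if q: "q \<in> ?A" for q
    proof -
      obtain t x y where txy: "q = (t, x, y)" by (cases q) auto
      have t: "t \<in> {0..T}" and w: "(x, y) \<in> \<omega>" and z: "(x, y) \<in> grushin_domain" using q txy by auto
      have "(\<Sum>n\<in>S. p n * V n q) = (\<Sum>i<Suc l. complex_of_real (t ^ i / fact i) *
          (\<Sum>n\<in>S. p n * (complex_of_real (exp (t - i) ^ n) * wave m n (Suc l - i) (x, y))))"
        unfolding V_def sum_distrib_left txy
        by (subst sum.swap, intro sum.cong refl) (simp add: weight_def mult_ac)
      also have "cmod \<dots> \<le> (\<Sum>i<Suc l. T ^ i / fact i * B)"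
      proof (intro sum_norm_le)
        fix i assume "i \<in> {..<Suc l}"
        \<comment> \<open>On the control region the angle stays out of the opening, and the modulus
          is at most \<open>exp T\<close>: the point lies in the sector for every
          \<open>i\<close>.\<close>
        have k: "complex_of_real (exp (t - i)) * cis (y - m) \<in> keyhole c (exp T)"
          using t c[OF w] by (simp add: keyhole_def norm_mult mult.commute)
        have "cmod (complex_of_real (t ^ i / fact i) *
            (\<Sum>n\<in>S. p n * (complex_of_real (exp (t - i) ^ n) * wave m n (Suc l - i) (x, y))))
          = t ^ i / fact i * cmod (\<Sum>n\<in>S. p n * (complex_of_real (exp (t - i) ^ n) * wave m n (Suc l - i) (x, y)))"
          using t by (simp only: norm_mult norm_of_real) simp
        also have "\<dots> \<le> T ^ i / fact i * B"
          using t T B by (intro mult_mono multiplier[OF k z] divide_right_mono power_mono) auto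
        finally show "cmod (complex_of_real (t ^ i / fact i) *
            (\<Sum>n\<in>S. p n * (complex_of_real (exp (t - i) ^ n) * wave m n (Suc l - i) (x, y)))) \<le> T ^ i / fact i * B" .
      qed
      finally show ?thesis by (simp only: E_def sum_distrib_right)
    qed
    have second: "cmod (\<Sum>n\<in>S. p n * (LINT q:?A|lborel. u q * V n q)) \<le> Cu * (E * B)"
    proof -
      have iV: "set_integrable lborel ?A (\<lambda>q. p n * (u q * V n q))" for n
      proof -
        have "set_integrable lborel ?A (\<lambda>q. u q * (complex_of_real (weight n i (fst q)) * wave m n j (snd q)))" for i j
        proof -
          have "compact (weight n i ` {0..T})"
            by (intro compact_continuous_image weight_continuous_on) auto
          then obtain C where C: "\<forall>x\<in>weight n i ` {0..T}. norm x \<le> C" using compact_imp_bounded bounded_iff by metis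
          show ?thesis
          proof (rule set_integrable_mult_bounded(1)[OF control_integrable, where C = C])
            show "(\<lambda>q. complex_of_real (weight n i (fst q)) * wave m n j (snd q)) \<in> borel_measurable borel"
              by (intro borel_measurable_times wm snd_measurable wave_measurable)
            fix q assume q: "q \<in> ?A"
            then have "\<bar>weight n i (fst q)\<bar> \<le> C" using C by auto
            moreover have "cmod (wave m n j (snd q)) \<le> 1" using q by (auto intro!: wave_bounded)
            ultimately show "cmod (complex_of_real (weight n i (fst q)) * wave m n j (snd q)) \<le> C"
              using mult_mono[of "\<bar>weight n i (fst q)\<bar>" C "cmod (wave m n j (snd q))" 1] by (simp add: norm_mult)
          qed
        qed
        then show ?thesis
          unfolding V_def sum_distrib_left by (intro set_integrable_sum set_integrable_mult_right)
      qed
      have "(\<Sum>n\<in>S. p n * (LINT q:?A|lborel. u q * V n q)) = (LINT q:?A|lborel. \<Sum>n\<in>S. p n * (u q * V n q))"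
        by (simp add: set_integral_sum[OF iV])
      also have "\<dots> = (LINT q:?A|lborel. u q * (\<Sum>n\<in>S. p n * V n q))"
        by (simp add: sum_distrib_left mult_ac)
      also have "cmod \<dots> \<le> Cu * (E * B)"
        unfolding Cu_def
        by (rule set_integrable_mult_bounded(2)[OF control_integrable _ V])
           (intro borel_measurable_sum borel_measurable_times Vm borel_measurable_const)
      finally show ?thesis .
    qed
    have split: "(\<Sum>n\<in>S. p n * (LINT z:grushin_domain|lborel. f0 z * wave m n (Suc l) z))
      = (\<Sum>n\<in>S. p n * (LINT t:{0..T}|lborel. W n t * \<phi> n t)) - (\<Sum>n\<in>S. p n * (LINT q:?A|lborel. u q * V n q))"
      unfolding moment_identity W_def[symmetric] \<phi>_def[symmetric] V_def[symmetric]
      by (simp only: right_diff_distrib sum_subtractf)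
    have "cmod (\<Sum>n\<in>S. p n * (LINT z:grushin_domain|lborel. f0 z * wave m n (Suc l) z))
      \<le> T * (Cf * (T ^ l / fact l * B)) + Cu * (E * B)"
      unfolding split by (rule order_trans[OF norm_triangle_ineq4 add_mono[OF first second]])
    then show "cmod (\<Sum>n\<in>S. p n * (LINT z:grushin_domain|lborel. f0 z * wave m n (Suc l) z))
      \<le> (T * Cf * (T ^ l / fact l) + Cu * E) * B"
      by (simp add: algebra_simps)
  qed
qed

end

section \<open>The initial state and the contradiction\<close>

lemma integral_lborel_product:
  fixes g h :: "real \<Rightarrow> complex"
  assumes g: "integrable lborel g" and h: "integrable lborel h"
  shows "(LINT z|lborel. g (fst z) * h (snd z)) = (LINT x|lborel. g x) * (LINT y|lborel. h y)"
proof -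
  have m: "(\<lambda>z. g (fst z) * h (snd z)) \<in> borel_measurable (lborel \<Otimes>\<^sub>M lborel)"
    using measurable_compose[OF measurable_fst borel_measurable_integrable[OF g]]
      measurable_compose[OF measurable_snd borel_measurable_integrable[OF h]]
    by (intro borel_measurable_times) auto
  have "integrable (lborel \<Otimes>\<^sub>M lborel) (\<lambda>z. g (fst z) * h (snd z))"
    using m g h by (intro lborel_pair.Fubini_integrable) (auto simp: norm_mult)
  from lborel_pair.integral_fst'[OF this] show ?thesis
    by (simp add: lborel_prod)
qed

lemma integral_cis_period:
  "(LINT y:{0..<2 * pi}|lborel. cis (of_int k * (y - m))) = (if k = 0 then 2 * pi else 0)"
proof -
  have "(LINT y:{0..<2 * pi}|lborel. cis (of_int k * (y - m))) = (LINT y:{0..2 * pi}|lborel. cis (of_int k * (y - m)))"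
    unfolding set_lebesgue_integral_def
  proof (rule integral_cong_AE)
    show "AE y in lborel. indicator {0..<2 * pi} y *\<^sub>R cis (of_int k * (y - m)) = indicator {0..2 * pi} y *\<^sub>R cis (of_int k * (y - m))"
      using AE_lborel_singleton[of "2 * pi"] by eventually_elim (auto simp: indicator_def)
  qed (intro borel_measurable_scaleR borel_measurable_indicator; auto intro!: borel_measurable_continuous_onI continuous_intros)+
  also have "\<dots> = (if k = 0 then 2 * pi else 0)"
  proof (cases "k = 0")
    case True
    then show ?thesis by (simp add: set_lebesgue_integral_def scaleR_conv_of_real)
  next
    case False
    define F where "F y = cis (of_int k * (y - m)) / (of_int k * \<i>)" for y :: real
    have "(F has_vector_derivative cis (of_int k * (y - m))) (at y within {0..2 * pi})" for y
    proof -
      have "((\<lambda>y. cis (of_int k * (y - m)) * (1 / (of_int k * \<i>))) has_vector_derivative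
          complex_of_real (of_int k) * \<i> * cis (of_int k * (y - m)) * (1 / (of_int k * \<i>))) (at y within {0..2 * pi})"
        by (intro has_vector_derivative_mult_left has_vector_derivative_at_within[OF cis_has_vector_derivative])
      then show ?thesis using False by (simp add: F_def[abs_def])
    qed
    then have "(LINT y|lborel. indicator {0..2 * pi} y *\<^sub>R cis (of_int k * (y - m))) = F (2 * pi) - F 0"
      by (intro integral_FTC_atLeastAtMost continuous_intros) auto
    also have "F (2 * pi) = F 0"
    proof -
      have "cis (of_int k * (2 * pi - m)) = cis (of_int k * (0 - m)) * cis (2 * pi * of_int k)"
        by (simp add: cis_mult algebra_simps)
      then show ?thesis by (simp add: F_def cis_multiple_2pi)
    qed
    finally show ?thesis using False by (simp add: set_lebesgue_integral_def)
  qed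
  finally show ?thesis .
qed

text \<open>The state is a Fourier series in \<open>y\<close>, cut off to
  \<open>0 \<le> x \<le> d\<close>. Its coefficients are the desired moments divided by
  \<open>2 pi\<close> times the integral of the mode over \<open>{0..d}\<close>. By
  \<open>mode_lower_bound\<close> these integrals decay more slowly than the moments, so the
  coefficients are summable.\<close>

lemma initial_datum:
  obtains f0 where "f0 square_integrable_on grushin_domain"
    and "\<And>n. (LINT z:grushin_domain|lborel. f0 z * wave m n L z) = complex_of_real (exp (- 1/2)) ^ n"
proof -
  \<comment> \<open>Makes the rate \<open>3 * d * (L + 1)\<close> of \<open>mode_lower_bound\<close>
    equal to 1/4, half the rate of the moments.\<close>
  define d :: real where "d = 1 / (12 * (L + 1))"
  define N where "N n = integral {0..d} (mode n L)" for n
  define \<kappa> where "\<kappa> = d * d ^ (2 * L)"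
  define a where "a n = exp (- 1/2) ^ n / (2 * pi * N n)" for n
  have d: "0 < d" "d \<le> 1/2" "3 * d * (L + 1) = 1/4"
    by (auto simp: d_def field_simps)
  have \<kappa>: "0 < \<kappa>" using d by (simp add: \<kappa>_def)
  have N: "\<kappa> * exp (- 1/4) ^ n \<le> N n" for n
  proof -
    have "exp (- 3 * d) ^ (n * (L + 1)) = exp (real (n * (L + 1)) * (- 3 * d))"
      by (rule exp_of_nat_mult[symmetric])
    also have "real (n * (L + 1)) * (- 3 * d) = - real n * (3 * d * (L + 1))"
      by (simp add: algebra_simps)
    also have "\<dots> = real n * (- 1/4)" unfolding d(3) by simp
    also have "exp (real n * (- 1/4)) = exp (- 1/4) ^ n" by (rule exp_of_nat_mult)
    finally have e: "exp (- 3 * d) ^ (n * (L + 1)) = exp (- 1/4) ^ n" .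
    have "\<kappa> * exp (- 1/4) ^ n = integral {0..d} (\<lambda>x. d ^ (2 * L) * exp (- 1/4) ^ n)"
      using d by (simp add: \<kappa>_def)
    also have "\<dots> \<le> N n"
      unfolding N_def
    proof (rule integral_le)
      show "d ^ (2 * L) * exp (- 1/4) ^ n \<le> mode n L x" if "x \<in> {0..d}" for x
        using mode_lower_bound[of x d L n] d that unfolding e by auto
    qed (intro integrable_continuous_real continuous_intros)+
    finally show ?thesis .
  qed
  have Npos: "0 < N n" for n
    using N[of n] \<kappa> by (intro less_le_trans[OF _ N]) auto
  have a0: "0 \<le> a n" for n using Npos[of n] by (simp add: a_def)
  have a_le: "a n \<le> 1 / (2 * pi * \<kappa>) * exp (- 1/4) ^ n" for n
  proof -
    have "exp (- 1/2) ^ n / (2 * pi * N n) \<le> exp (- 1/2) ^ n / (2 * pi * (\<kappa> * exp (- 1/4) ^ n))"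
      using N[of n] \<kappa> Npos[of n] by (intro divide_left_mono mult_left_mono mult_pos_pos) auto
    also have "\<dots> = 1 / (2 * pi * \<kappa>) * exp (- 1/4) ^ n"
    proof -
      have "exp (- 1/2 :: real) ^ n = exp (- 1/4) ^ n * exp (- 1/4) ^ n"
        by (simp add: power_mult_distrib[symmetric] mult_exp_exp)
      then show ?thesis by simp
    qed
    finally show ?thesis unfolding a_def .
  qed
  have "summable (\<lambda>n. 1 / (2 * pi * \<kappa>) * exp (- 1/4 :: real) ^ n)"
    by (intro summable_mult summable_geometric) simp
  then have sa: "summable a"
    by (rule summable_comparison_test'[where N = 0]) (use a0 a_le in auto)
  \<comment> \<open>The frequencies are negative because the pairing with \<open>wave\<close>
    involves no conjugation; orthogonality then isolates the \<open>n\<close>-th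
    coefficient.\<close>
  define F where "F y = (\<Sum>k. complex_of_real (a k) * cis (- real k * (y - m)))" for y
  have sF: "summable (\<lambda>k. norm (complex_of_real (a k) * cis (- real k * (y - m)) * w))" for y w
    using summable_mult2[OF sa, of "norm w"] a0 by (simp add: norm_mult)
  have Fm: "F \<in> borel_measurable borel"
    unfolding F_def
    by (intro borel_measurable_suminf borel_measurable_continuous_onI continuous_intros)
  have FB: "cmod (F y) \<le> suminf a" for y
  proof -
    have "cmod (F y) \<le> (\<Sum>k. norm (complex_of_real (a k) * cis (- real k * (y - m))))"
      unfolding F_def using sF[of y 1] by (intro summable_norm) simp
    then show ?thesis using a0 by (simp add: norm_mult)
  qed
  define f0 where "f0 z = indicator {0..d} (fst z) *\<^sub>R F (snd z)" for z :: "real \<times> real"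
  have fstm: "(fst :: real \<times> real \<Rightarrow> real) \<in> borel_measurable borel" and sndm: "(snd :: real \<times> real \<Rightarrow> real) \<in> borel_measurable borel"
    by (auto intro!: borel_measurable_continuous_onI continuous_on_fst continuous_on_snd)
  have f0m: "f0 \<in> borel_measurable borel"
    unfolding f0_def
    by (intro borel_measurable_scaleR measurable_compose[OF fstm borel_measurable_indicator] measurable_compose[OF sndm Fm]) auto
  have f0B: "(cmod (f0 z))\<^sup>2 \<le> (suminf a)\<^sup>2" for z
    using FB[of "snd z"] by (intro power_mono) (auto simp: f0_def indicator_def intro: order_trans[OF norm_ge_zero])
  have "f0 square_integrable_on grushin_domain"
    unfolding square_integrable_on_def
  proof
    show "set_borel_measurable lborel grushin_domain f0"
      unfolding set_borel_measurable_def using f0m by (intro borel_measurable_scaleR borel_measurable_indicator) auto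
    show "set_integrable lborel grushin_domain (\<lambda>z. (cmod (f0 z))\<^sup>2)"
    proof (rule set_integrable_bound)
      show "set_integrable lborel grushin_domain (\<lambda>z. (suminf a)\<^sup>2)"
        using grushin_domain_finite by (simp add: set_integrable_def)
      show "set_borel_measurable lborel grushin_domain (\<lambda>z. (cmod (f0 z))\<^sup>2)"
        unfolding set_borel_measurable_def using f0m by (intro borel_measurable_scaleR borel_measurable_indicator borel_measurable_power borel_measurable_norm) auto
    qed (use f0B in auto)
  qed
  moreover have "(LINT z:grushin_domain|lborel. f0 z * wave m n L z) = complex_of_real (exp (- 1/2)) ^ n" for n
  proof -
    define g where "g x = complex_of_real (indicator {0..d} x *\<^sub>R mode n L x)" for x
    define H where "H k y = indicator {0..<2 * pi} y *\<^sub>R (complex_of_real (a k) * cis (- real k * (y - m)) * cis (n * (y - m)))" for k y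
    have gi: "integrable lborel g"
      unfolding g_def using borel_integrable_atLeastAtMost'[OF mode_continuous_on, of 0 d n L]
      by (simp only: set_integrable_def integrable_of_real)
    have Ig: "(LINT x|lborel. g x) = N n"
    proof -
      have "(LINT x:{0..d}|lborel. mode n L x) = N n"
        unfolding N_def by (intro set_borel_integral_eq_integral(2) borel_integrable_atLeastAtMost' continuous_intros)
      then show ?thesis by (simp only: g_def integral_complex_of_real set_lebesgue_integral_def)
    qed
    have Hi: "integrable lborel (H k)" for k
    proof -
      have "set_integrable lborel {0..2 * pi} (\<lambda>y. complex_of_real (a k) * cis (- real k * (y - m)) * cis (n * (y - m)))"
        by (intro borel_integrable_atLeastAtMost' continuous_intros)
      then have "set_integrable lborel {0..<2 * pi} (\<lambda>y. complex_of_real (a k) * cis (- real k * (y - m)) * cis (n * (y - m)))"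
        by (rule set_integrable_subset) auto
      then show ?thesis by (simp only: set_integrable_def H_def[abs_def])
    qed
    have IH: "(LINT y|lborel. H k y) = (if k = n then complex_of_real (2 * pi * a n) else 0)" for k
    proof -
      have "complex_of_real (a k) * cis (- real k * (y - m)) * cis (n * (y - m))
        = complex_of_real (a k) * cis (of_int (int n - int k) * (y - m))" for y
        by (simp add: cis_mult mult.assoc algebra_simps)
      then have "(LINT y|lborel. H k y) = (LINT y:{0..<2 * pi}|lborel. complex_of_real (a k) * cis (of_int (int n - int k) * (y - m)))"
        by (simp only: H_def[abs_def] set_lebesgue_integral_def)
      also have "\<dots> = complex_of_real (a k) * (LINT y:{0..<2 * pi}|lborel. cis (of_int (int n - int k) * (y - m)))"
        by (rule set_integral_mult_right)
      finally show ?thesis unfolding integral_cis_period by (simp add: mult_ac)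
    qed
    \<comment> \<open>The norm is the constant \<open>a k\<close> over one period, so summability of
      \<open>a\<close> justifies integrating the series term by term.\<close>
    have normH: "norm (H k y) = indicator {0..<2 * pi} y * a k" for k y
      using a0[of k] by (simp add: H_def norm_mult indicator_def)
    have sH: "summable (\<lambda>k. norm (H k y))" for y
      unfolding normH by (intro summable_mult sa)
    have sIH: "summable (\<lambda>k. LINT y|lborel. norm (H k y))"
      unfolding normH using summable_mult[OF sa, of "2 * pi"] by (simp add: mult.commute)
    have sums: "(\<Sum>k. H k y) = indicator {0..<2 * pi} y *\<^sub>R (F y * cis (n * (y - m)))" for y
    proof -
      have "summable (\<lambda>k. complex_of_real (a k) * cis (- real k * (y - m)))"
        using sF[of y 1] by (intro summable_norm_cancel[of "\<lambda>k. complex_of_real (a k) * cis (- real k * (y - m))"]) simp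
      then have "(\<lambda>k. complex_of_real (a k) * cis (- real k * (y - m)) * cis (n * (y - m))) sums (F y * cis (n * (y - m)))"
        unfolding F_def by (intro sums_mult2 summable_sums)
      then have "(\<lambda>k. H k y) sums (indicator {0..<2 * pi} y *\<^sub>R (F y * cis (n * (y - m))))"
        unfolding H_def by (intro sums_scaleR_right)
      then show ?thesis by (rule sums_unique[symmetric])
    qed
    have "(LINT y|lborel. (\<Sum>k. H k y)) = (\<Sum>k. LINT y|lborel. H k y)"
      by (rule integral_suminf[OF Hi]) (use sH sIH in auto)
    also have "\<dots> = complex_of_real (2 * pi * a n)"
      unfolding IH using sums_single[of n "\<lambda>_. complex_of_real (2 * pi * a n)"] sums_unique by (metis (no_types))
    finally have IF: "(LINT y|lborel. indicator {0..<2 * pi} y *\<^sub>R (F y * cis (n * (y - m)))) = complex_of_real (2 * pi * a n)"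
      unfolding sums .
    have iF: "integrable lborel (\<lambda>y. indicator {0..<2 * pi} y *\<^sub>R (F y * cis (n * (y - m))))"
      unfolding sums[symmetric] by (rule integrable_suminf[OF Hi]) (use sH sIH in auto)
    have "(LINT z:grushin_domain|lborel. f0 z * wave m n L z)
      = (LINT z|lborel. g (fst z) * (indicator {0..<2 * pi} (snd z) *\<^sub>R (F (snd z) * cis (n * (snd z - m)))))"
      unfolding set_lebesgue_integral_def
    proof (rule Bochner_Integration.integral_cong)
      fix z :: "real \<times> real"
      obtain x y where z: "z = (x, y)" by fastforce
      show "indicator grushin_domain z *\<^sub>R (f0 z * wave m n L z)
        = g (fst z) * (indicator {0..<2 * pi} (snd z) *\<^sub>R (F (snd z) * cis (n * (snd z - m))))"
        using d by (auto simp: z grushin_domain_def f0_def g_def wave_def indicator_def)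
    qed simp
    also have "\<dots> = N n * complex_of_real (2 * pi * a n)"
      unfolding integral_lborel_product[OF gi iF] Ig IF ..
    also have "\<dots> = complex_of_real (exp (- 1/2)) ^ n"
    proof -
      have "N n * (2 * pi * a n) = exp (- 1/2) ^ n" using Npos[of n] by (simp add: a_def)
      then show ?thesis by (simp only: of_real_mult[symmetric] of_real_power[symmetric])
    qed
    finally show ?thesis .
  qed
  ultimately show thesis by (rule that)
qed

section \<open>Separating a point from the keyhole\<close>

text \<open>The function \<open>1 / (s0 - z)\<close> with pole just to the right of \<open>x\<close>
  has modulus \<open>4 / \<kappa>\<close> at \<open>x\<close> and at most
  \<open>1 / \<kappa>\<close> on the keyhole; a polynomial within \<open>1 / \<kappa>\<close> of it
  still separates them. It exists because the pole can be pushed to infinity along the real ray,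
  through the opening.\<close>

lemma peak_polynomial:
  assumes c: "0 \<le> c" "c < 1" and x: "1/2 < x"
  obtains q b where "\<And>z. z \<in> keyhole c M \<Longrightarrow> cmod (poly q z) \<le> b"
    and "b < cmod (poly q (complex_of_real x))"
proof -
  \<comment> \<open>A lower bound for the distance from the ray starting at \<open>x\<close> to the
    keyhole: \<open>x - 1/2\<close> for the disc, \<open>x\<close> times the sine of the
    half-opening for the sector.\<close>
  define \<kappa> where "\<kappa> = min (x - 1/2) (x * sqrt (1 - c\<^sup>2))"
  have c2: "0 < 1 - c\<^sup>2" using c by (simp add: power_less_one_iff abs_square_less_1)
  then have \<kappa>: "0 < \<kappa>" using x by (simp add: \<kappa>_def)
  have far: "\<kappa> \<le> cmod (complex_of_real s - z)" if s: "x \<le> s" and z: "z \<in> keyhole c M" for s z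
  proof (cases "cmod z \<le> 1/2")
    case True
    have "s - 1/2 \<le> cmod (complex_of_real s) - cmod z" using True s x by simp
    also have "\<dots> \<le> cmod (complex_of_real s - z)" by (rule norm_triangle_ineq2)
    finally show ?thesis using s by (simp add: \<kappa>_def)
  next
    case False
    then have re: "Re z \<le> c * cmod z" using z by (simp add: keyhole_def)
    \<comment> \<open>The law of cosines, with the square in \<open>cmod z\<close>
      completed.\<close>
    have "s\<^sup>2 * (1 - c\<^sup>2) \<le> s\<^sup>2 * (1 - c\<^sup>2) + (cmod z - s * c)\<^sup>2" by simp
    also have "\<dots> = s\<^sup>2 - 2 * s * (c * cmod z) + (cmod z)\<^sup>2" by (simp add: power2_eq_square algebra_simps)
    also have "\<dots> \<le> s\<^sup>2 - 2 * s * Re z + (cmod z)\<^sup>2"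
      using mult_left_mono[OF re, of "2 * s"] s x by simp
    also have "\<dots> = (cmod (complex_of_real s - z))\<^sup>2"
      unfolding cmod_power2 by (simp add: power2_eq_square algebra_simps)
    finally have "sqrt (s\<^sup>2 * (1 - c\<^sup>2)) \<le> cmod (complex_of_real s - z)"
      by (simp add: real_le_lsqrt)
    moreover have "sqrt (s\<^sup>2 * (1 - c\<^sup>2)) = s * sqrt (1 - c\<^sup>2)"
      using s x by (simp add: real_sqrt_mult)
    moreover have "x * sqrt (1 - c\<^sup>2) \<le> s * sqrt (1 - c\<^sup>2)"
      using s c2 by (intro mult_right_mono) auto
    ultimately show ?thesis by (simp add: \<kappa>_def)
  qed
  \<comment> \<open>The point \<open>x\<close> is added because the approximation is also evaluated
    there. Its distance to the pole is only \<kappa>/4, which is therefore the distance used on the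
    whole ray.\<close>
  define S where "S = insert (complex_of_real x) (keyhole c M)"
  define s0 where "s0 = x + \<kappa> / 4"
  have "poly_approximable S (\<lambda>z. 1 / (complex_of_real s0 - z))"
  proof (rule poly_approximable_pole_on_ray[of _ "max \<bar>x\<bar> (max (1/2) M)" "\<kappa> / 4"])
    show "cmod z \<le> max \<bar>x\<bar> (max (1/2) M)" if "z \<in> S" for z
      using that by (auto simp: S_def keyhole_def)
    show "\<kappa> / 4 \<le> cmod (complex_of_real s - z)" if "s0 \<le> s" "z \<in> S" for s z
    proof (cases "z = complex_of_real x")
      case True
      then show ?thesis using that \<kappa> by (simp add: s0_def flip: of_real_diff)
    next
      case False
      then have "\<kappa> \<le> cmod (complex_of_real s - z)"
        using that \<kappa> by (intro far) (auto simp: S_def s0_def)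
      then show ?thesis using \<kappa> by simp
    qed
  qed (use \<kappa> in simp)
  then obtain q where q: "\<And>z. z \<in> S \<Longrightarrow> cmod (1 / (complex_of_real s0 - z) - poly q z) < 1 / \<kappa>"
    using \<kappa> unfolding poly_approximable_def by (meson zero_less_divide_1_iff)
  show thesis
  proof (rule that[of q "2 / \<kappa>"])
    fix z assume z: "z \<in> keyhole c M"
    have "\<kappa> \<le> cmod (complex_of_real s0 - z)" using \<kappa> z by (intro far) (auto simp: s0_def)
    then have "cmod (1 / (complex_of_real s0 - z)) \<le> 1 / \<kappa>"
      using \<kappa> by (simp add: norm_divide frac_le)
    moreover have "cmod (1 / (complex_of_real s0 - z) - poly q z) < 1 / \<kappa>" using q z by (simp add: S_def)
    moreover have "cmod (poly q z) \<le> cmod (1 / (complex_of_real s0 - z)) + cmod (1 / (complex_of_real s0 - z) - poly q z)"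
      by (metis norm_minus_commute norm_triangle_sub)
    ultimately have "cmod (poly q z) \<le> 1 / \<kappa> + 1 / \<kappa>" by linarith
    then show "cmod (poly q z) \<le> 2 / \<kappa>" by simp
  next
    have "cmod (1 / (complex_of_real s0 - complex_of_real x)) = 4 / \<kappa>"
      using \<kappa> by (simp add: s0_def norm_divide)
    moreover have "cmod (1 / (complex_of_real s0 - complex_of_real x) - poly q (complex_of_real x)) < 1 / \<kappa>"
      using q by (simp add: S_def)
    moreover have "cmod (1 / (complex_of_real s0 - complex_of_real x))
        \<le> cmod (poly q (complex_of_real x)) + cmod (1 / (complex_of_real s0 - complex_of_real x) - poly q (complex_of_real x))"
      by (rule norm_triangle_sub)
    ultimately have "4 / \<kappa> < cmod (poly q (complex_of_real x)) + 1 / \<kappa>" by linarith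
    moreover have "2 / \<kappa> + 1 / \<kappa> < 4 / \<kappa>" using \<kappa> by (simp add: field_simps)
    ultimately show "2 / \<kappa> < cmod (poly q (complex_of_real x))" by linarith
  qed
qed

section \<open>The removed segment on the circle\<close>

lemma torus_segment_borel: "torus_segment a b \<in> sets borel"
proof -
  have "torus_segment a b = (\<Union>k::int. {a - 2 * pi * of_int k..b - 2 * pi * of_int k})"
    by (auto simp: torus_segment_def algebra_simps)
  then show ?thesis by auto
qed

text \<open>Subtracting the nearest multiple of the period moves \<open>y - m\<close> into
  \<open>{-pi..pi}\<close>. There the cosine exceeds \<open>cos d\<close> only at distance less than
  \<open>d\<close> from 0, that is, for points of the segment.\<close>

lemma cos_le_outside_torus_segment:
  assumes y: "y \<notin> torus_segment a b" and d: "0 \<le> d" "d \<le> pi"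
    and sub: "{m - d..m + d} \<subseteq> {a..b}"
  shows "cos (y - m) \<le> cos d"
proof (rule ccontr)
  assume "\<not> cos (y - m) \<le> cos d"
  define k where "k = - round ((y - m) / (2 * pi))"
  define t where "t = y - m + 2 * pi * of_int k"
  have "\<bar>of_int (round ((y - m) / (2 * pi))) - (y - m) / (2 * pi)\<bar> \<le> 1/2"
    by (rule of_int_round_abs_le)
  then have "2 * pi * \<bar>of_int (round ((y - m) / (2 * pi))) - (y - m) / (2 * pi)\<bar> \<le> 2 * pi * (1/2)"
    by (intro mult_left_mono) auto
  also have "2 * pi * \<bar>of_int (round ((y - m) / (2 * pi))) - (y - m) / (2 * pi)\<bar> = \<bar>t\<bar>"
  proof -
    have "t = 2 * pi * ((y - m) / (2 * pi) - of_int (round ((y - m) / (2 * pi))))"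
    proof -
      have "2 * pi * ((y - m) / (2 * pi)) = y - m" by simp
      then show ?thesis unfolding right_diff_distrib t_def k_def by simp
    qed
    then show ?thesis by (simp add: abs_mult abs_minus_commute)
  qed
  finally have t: "\<bar>t\<bar> \<le> pi" by simp
  have "cos t = cos (y - m)"
    unfolding t_def cos_add by simp
  then have "cos d < cos \<bar>t\<bar>" using \<open>\<not> cos (y - m) \<le> cos d\<close> by simp
  then have "\<bar>t\<bar> < d" using d t by (intro cos_mono_less_eq[THEN iffD1, of d "\<bar>t\<bar>"]) auto
  then have "y + 2 * pi * of_int k \<in> {m - d..m + d}" by (auto simp: t_def)
  then have "y + 2 * pi * of_int k \<in> {a..b}" using sub by blast
  then show False using y unfolding torus_segment_def by blast
qed

theorem theorem2:
  fixes a b T :: real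
  assumes "a < b" and "T > 0"
  shows "\<not> null_controllable ({-1<..<1} \<times> (- torus_segment a b)) T"
proof
  let ?\<omega> = "{-1<..<1} \<times> (- torus_segment a b)"
  assume nc: "null_controllable ?\<omega> T"
  \<comment> \<open>Half of the length or 1/2: \<open>{m - d..m + d}\<close> fits into
    \<open>{a..b}\<close>, and \<open>d \<le> 1/2\<close> keeps \<open>cos d\<close>
    nonnegative.\<close>
  define d where "d = min (b - a) 1 / 2"
  define m where "m = a + d"
  define c where "c = cos d"
  define l where "l = nat \<lceil>T\<rceil>"
  define x :: real where "x = exp (- 1/2)"
  have l: "T \<le> real l" by (simp add: l_def real_nat_ceiling_ge)
  have d: "0 < d" "d \<le> 1/2" "2 * d \<le> b - a" using assms by (auto simp: d_def)
  have c: "0 \<le> c" "c < 1"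
    using d pi_gt3 cos_monotone_0_pi[of 0 d] unfolding c_def by (auto intro!: cos_ge_zero)
  have cos: "cos (y - m) \<le> c" if "(x', y) \<in> ?\<omega>" for x' y
    unfolding c_def using that d pi_gt3
    by (intro cos_le_outside_torus_segment[of y a b]) (auto simp: m_def)
  \<comment> \<open>As a positive real outside the small disc, \<open>x\<close> lies in the opening
    of the keyhole. The estimate is \<open>exp 1 < 4\<close> in disguise.\<close>
  have x: "1/2 < x"
  proof -
    have "(exp (1/2))\<^sup>2 = exp (1::real)" by (simp add: power2_eq_square mult_exp_exp)
    also have "\<dots> < 2\<^sup>2" using exp_le by simp
    finally have "exp (1/2) < (2::real)" by (rule power_less_imp_less_base) simp
    then show ?thesis by (simp add: x_def exp_minus field_simps)
  qed
  obtain f0 where f0: "f0 square_integrable_on grushin_domain"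
    and moments: "\<And>n. (LINT z:grushin_domain|lborel. f0 z * wave m n (Suc l) z) = complex_of_real x ^ n"
    using initial_datum[of m "Suc l"] unfolding x_def by blast
  from nc f0 obtain u f where u: "u square_integrable_on ({0..T} \<times> (?\<omega> \<inter> grushin_domain))"
    and f: "grushin_solution ?\<omega> T f0 u f" "AE z\<in>grushin_domain in lborel. f T z = 0"
    unfolding null_controllable_def by blast
  have "?\<omega> \<inter> grushin_domain = {-1<..<1} \<times> (- torus_segment a b \<inter> {0..<2 * pi})"
    by (auto simp: grushin_domain_def)
  then have "?\<omega> \<inter> grushin_domain \<in> sets borel"
    using torus_segment_borel[of a b] by (auto intro!: borel_Times)
  then interpret controlled_solution ?\<omega> T f0 u f
    using u f assms by unfold_locales auto
  obtain C where C: "\<And>(S :: nat set) (p :: nat \<Rightarrow> complex) B. finite S \<Longrightarrow>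
      (\<And>z. z \<in> keyhole c (exp T) \<Longrightarrow> cmod (\<Sum>n\<in>S. p n * z ^ n) \<le> B) \<Longrightarrow>
      cmod (\<Sum>n\<in>S. p n * complex_of_real x ^ n) \<le> C * B"
  proof (rule observability_bound[OF cos l, unfolded moments])
    fix C
    assume "\<And>(S :: nat set) (p :: nat \<Rightarrow> complex) B. finite S \<Longrightarrow>
      (\<And>z. z \<in> keyhole c (exp T) \<Longrightarrow> cmod (\<Sum>n\<in>S. p n * z ^ n) \<le> B) \<Longrightarrow>
      cmod (\<Sum>n\<in>S. p n * complex_of_real x ^ n) \<le> C * B"
    then show thesis by (rule that)
  qed
  obtain q b where q: "\<And>z. z \<in> keyhole c (exp T) \<Longrightarrow> cmod (poly q z) \<le> b"
    and peak: "b < cmod (poly q (complex_of_real x))"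
    using peak_polynomial[OF c x] by blast
  define r where "r = cmod (poly q (complex_of_real x))"
  have b: "0 \<le> b" by (rule order_trans[OF norm_ge_zero q[of 0]]) (simp add: keyhole_def)
  \<comment> \<open>The bound is applied to the coefficients of \<open>q ^ k\<close>, whose modulus
    on the keyhole is at most \<open>b ^ k\<close>, with one \<open>C\<close> for all
    \<open>k\<close>.\<close>
  have le: "r ^ k \<le> C * b ^ k" for k
  proof -
    have "cmod (\<Sum>n\<le>degree (q ^ k). coeff (q ^ k) n * complex_of_real x ^ n) \<le> C * b ^ k"
    proof (rule C)
      show "cmod (\<Sum>n\<le>degree (q ^ k). coeff (q ^ k) n * z ^ n) \<le> b ^ k" if "z \<in> keyhole c (exp T)" for z
        using power_mono[OF q[OF that], of k] by (simp add: poly_altdef[symmetric] poly_power norm_power)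
    qed simp
    then show ?thesis by (simp add: r_def poly_altdef[symmetric] poly_power norm_power)
  qed
  show False
  \<comment> \<open>The growth of \<open>(r / b) ^ k\<close> requires a nonzero \<open>b\<close>;
    for \<open>b = 0\<close> the case \<open>k = 1\<close> is already contradictory.\<close>
  proof (cases "b = 0")
    case True
    with le[of 1] peak show False by (simp add: r_def)
  next
    case False
    with b have "0 < b" by simp
    then have "1 < r / b" using peak by (simp add: r_def)
    then obtain k where "C < (r / b) ^ k" using real_arch_pow by blast
    then show False using le[of k] \<open>0 < b\<close> by (simp add: power_divide field_simps)
  qed
qed

end
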